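(* Let $T\ge 1$, let $x_1\in\mathbb{R}$, and for $k=1,\dots,T$ let $c_k\ge 0$, let $L_k\le U_k$ be real numbers, let $\mathcal{W}_k=[\underline{w}_k,\overline{w}_k]\subset\mathbb{R}$ be a compact interval, and let $h_k:\mathbb{R}\to\mathbb{R}$ be convex and coercive. Let $J_k^*$ ($1\le k\le T+1$) be the optimal value functions defined by the Bellman recursion given in the context, and let $J_{mM}=J_1^*(x_1)$. For $k\ge 1$ write $w^k=(w_1,\dots,w_{k-1})$. Then for every time step $k=1,\dots,T$ there exist an affine control policy $$q_k(w^k)=q_{k,0}+\sum_{t=1}^{k-1}q_{k,t}\,w_t$$ and an affine running cost $$z_k(w^{k+1})=z_{k,0}+\sum_{t=1}^{k}z_{k,t}\,w_t$$ (with real coefficients $q_{k,t},z_{k,t}$) such that, for every $k\in\{1,\dots,T\}$, the following hold: 1. $L_k\le q_k(w^k)\le U_k$ for all $w^k\in\mathcal{W}_1\times\dots\times\mathcal{W}_{k-1}$; 2. $z_k(w^{k+1})\ge h_k\Big(x_1+\sum_{t=1}^{k}\big(q_t(w^t)+w_t\big)\Big)$ for all $w^{k+1}\in\mathcal{W}_1\times\dots\times\mathcal{W}_k$; 3. $$J_{mM}=\max_{w_1\in\mathcal{W}_1,\dots,w_k\in\mathcal{W}_k}\left[\sum_{t=1}^{k}\Big(c_t\,q_t(w^t)+z_t(w^{t+1})\Big)+J_{k+1}^*\Big(x_1+\sum_{t=1}^{k}\big(q_t(w^t)+w_t\big)\Big)\right].$$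
   Context: The underlying problem is a one-dimensional multi-stage robust (min-max) control problem with dynamics $x_{k+1}=x_k+u_k+w_k$, initial state $x_1$, controls $u_k\in[L_k,U_k]$ chosen after observing $w_1,\dots,w_{k-1}$, adversarial disturbances $w_k\in\mathcal{W}_k$, and cost at time $k$ equal to $c_k u_k+h_k(x_{k+1})$. The optimal value functions are defined by the backward recursion $J_{T+1}^*\equiv 0$ and, for $k=T,\dots,1$, $$J_k^*(x)=\min_{L_k\le u\le U_k}\Big[c_k u+\max_{w\in\mathcal{W}_k}\big[h_k(x+u+w)+J_{k+1}^*(x+u+w)\big]\Big],\qquad x\in\mathbb{R},$$ and the optimal min-max value of the problem is $J_{mM}=J_1^*(x_1)$. "Coercive" means $h_k(x)\to+\infty$ as $|x|\to\infty$. The policy $q_1$ is a constant, since $w^1$ is empty. The policies and costs form a single family $\{q_t,z_t\}_{1\le t\le T}$ for which properties 1–3 hold at every $k$. *)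

theory Defs
  imports "HOL-Analysis.Analysis"
begin

text \<open>
  Stage-indexed data are functions on \<^typ>\<open>nat\<close> of which only the stages
  \<open>1, \<dots>, T\<close> matter; the values at other stages play no role. For \<open>k > T\<close> the
  value function is \<open>0\<close>, in particular at \<open>k = T + 1\<close>. The minimum over \<open>u\<close> and the
  maximum over \<open>w\<close> are written as \<open>INF\<close> and \<open>SUP\<close>; lemma \<open>opt_value_attained\<close> below
  shows that for convex \<open>h k\<close> and compact nonempty \<open>W k\<close> both are attained.
\<close>

function opt_value ::
  "nat \<Rightarrow> (nat \<Rightarrow> real) \<Rightarrow> (nat \<Rightarrow> real) \<Rightarrow> (nat \<Rightarrow> real) \<Rightarrow> (nat \<Rightarrow> real set) \<Rightarrow>
   (nat \<Rightarrow> real \<Rightarrow> real) \<Rightarrow> nat \<Rightarrow> real \<Rightarrow> real"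
where
  "opt_value T c L U W h k x =
     (if k > T then 0
      else INF u\<in>{L k..U k}. c k * u +
             (SUP w\<in>W k. h k (x + u + w) + opt_value T c L U W h (Suc k) (x + u + w)))"
  by auto
termination
  by (relation "Wellfounded.measure (\<lambda>(T, c, L, U, W, h, k, x). Suc T - k)") auto

declare opt_value.simps [simp del]

text \<open>
  \<open>affine_at a m w\<close> is the affine function with coefficients \<open>a 0, a 1, \<dots>, a (m - 1)\<close> evaluated
  at the history \<open>w\<^sup>m = (w\<^sub>1, \<dots>, w\<^bsub>m-1\<^esub>)\<close>.
\<close>

definition affine_at :: "(nat \<Rightarrow> real) \<Rightarrow> nat \<Rightarrow> (nat \<Rightarrow> real) \<Rightarrow> real" where
  "affine_at a m w = a 0 + (\<Sum>t\<in>{1..<m}. a t * w t)"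

text \<open>The product \<open>W\<^sub>1 \<times> \<dots> \<times> W\<^bsub>m-1\<^esub>\<close> of all histories \<open>w\<^sup>m\<close>; a single (empty) history for \<open>m = 1\<close>.\<close>

definition histories :: "(nat \<Rightarrow> real set) \<Rightarrow> nat \<Rightarrow> (nat \<Rightarrow> real) set" where
  "histories W m = (\<Pi>\<^sub>E t\<in>{1..<m}. W t)"

text \<open>The state \<open>x\<^bsub>k+1\<^esub>\<close> reached from \<open>x1\<close> under the affine policies with coefficients \<open>q\<close>.\<close>

definition state_after :: "real \<Rightarrow> (nat \<Rightarrow> nat \<Rightarrow> real) \<Rightarrow> nat \<Rightarrow> (nat \<Rightarrow> real) \<Rightarrow> real" where
  "state_after x1 q k w = x1 + (\<Sum>t=1..k. affine_at (q t) t w + w t)"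

definition is_max_on :: "('a \<Rightarrow> real) \<Rightarrow> 'a set \<Rightarrow> real \<Rightarrow> bool" where
  "is_max_on f S m \<longleftrightarrow> (\<exists>x\<in>S. f x = m) \<and> (\<forall>x\<in>S. f x \<le> m)"

definition is_min_on :: "('a \<Rightarrow> real) \<Rightarrow> 'a set \<Rightarrow> real \<Rightarrow> bool" where
  "is_min_on f S m \<longleftrightarrow> (\<exists>x\<in>S. f x = m) \<and> (\<forall>x\<in>S. m \<le> f x)"

lemma is_max_onE:
  assumes "is_max_on f S m"
  obtains x where "x \<in> S" "m = f x"
  using assms unfolding is_max_on_def by blast

lemma is_min_onE:
  assumes "is_min_on f S m"
  obtains x where "x \<in> S" "m = f x"
  using assms unfolding is_min_on_def by blast

lemma is_max_on_SUP:
  assumes "compact S" "S \<noteq> {}" "continuous_on S f"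
  shows "is_max_on f S (SUP x\<in>S. f x)"
proof -
  obtain x where x: "x \<in> S" "\<forall>y\<in>S. f y \<le> f x"
    using continuous_attains_sup[OF assms] by blast
  then have "(SUP x\<in>S. f x) = f x" by (intro cSup_eq_maximum) auto
  with x show ?thesis unfolding is_max_on_def by auto
qed

lemma is_min_on_INF:
  assumes "compact S" "S \<noteq> {}" "continuous_on S f"
  shows "is_min_on f S (INF x\<in>S. f x)"
proof -
  obtain x where x: "x \<in> S" "\<forall>y\<in>S. f x \<le> f y"
    using continuous_attains_inf[OF assms] by blast
  then have "(INF x\<in>S. f x) = f x" by (intro cInf_eq_minimum) auto
  with x show ?thesis unfolding is_min_on_def by auto
qed

lemma is_max_on_SUP_shift:
  fixes g :: "real \<Rightarrow> real"
  assumes "compact S" "S \<noteq> {}" "convex_on UNIV g"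
  shows "is_max_on (\<lambda>w. g (y + w)) S (SUP w\<in>S. g (y + w))"
proof -
  have "continuous_on UNIV g" by (rule convex_on_continuous[OF open_UNIV assms(3)])
  then have "continuous_on S (\<lambda>w. g (y + w))"
    by (rule continuous_on_compose2[of UNIV g]) (auto intro!: continuous_intros)
  with assms(1,2) show ?thesis by (rule is_max_on_SUP)
qed

lemma is_min_on_INF_shift:
  fixes g :: "real \<Rightarrow> real"
  assumes "l \<le> u" "convex_on UNIV g"
  shows "is_min_on (\<lambda>v. c * v + g (x + v)) {l..u} (INF v\<in>{l..u}. c * v + g (x + v))"
proof -
  have "continuous_on UNIV g" by (rule convex_on_continuous[OF open_UNIV assms(2)])
  then have "continuous_on {l..u} (\<lambda>v. g (x + v))"
    by (rule continuous_on_compose2[of UNIV g]) (auto intro!: continuous_intros)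
  with assms show ?thesis by (intro is_min_on_INF) (auto intro!: continuous_intros)
qed

lemma convex_on_SUP_shift:
  fixes g :: "real \<Rightarrow> real"
  assumes "compact S" "S \<noteq> {}" "convex_on UNIV g"
  shows "convex_on UNIV (\<lambda>y. SUP w\<in>S. g (y + w))"
proof (rule convex_onI)
  fix t x y :: real
  assume t: "0 < t" "t < 1"
  note m = is_max_on_SUP_shift[OF assms]
  obtain w where w: "w \<in> S"
    "(SUP w\<in>S. g (((1 - t) *\<^sub>R x + t *\<^sub>R y) + w)) = g (((1 - t) *\<^sub>R x + t *\<^sub>R y) + w)"
    using m[of "(1 - t) *\<^sub>R x + t *\<^sub>R y"] by (rule is_max_onE)
  have "g (((1 - t) *\<^sub>R x + t *\<^sub>R y) + w) = g ((1 - t) *\<^sub>R (x + w) + t *\<^sub>R (y + w))"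
    by (simp add: algebra_simps)
  also have "\<dots> \<le> (1 - t) * g (x + w) + t * g (y + w)"
    using assms(3) t by (intro convex_onD) auto
  also have "\<dots> \<le> (1 - t) * (SUP w\<in>S. g (x + w)) + t * (SUP w\<in>S. g (y + w))"
    using m[of x] m[of y] w(1) t unfolding is_max_on_def
    by (intro add_mono mult_left_mono) auto
  finally show "(SUP w\<in>S. g (((1 - t) *\<^sub>R x + t *\<^sub>R y) + w))
      \<le> (1 - t) * (SUP w\<in>S. g (x + w)) + t * (SUP w\<in>S. g (y + w))"
    using w(2) by simp
qed simp

lemma convex_on_INF_shift:
  fixes g :: "real \<Rightarrow> real"
  assumes "l \<le> u" "convex_on UNIV g"
  shows "convex_on UNIV (\<lambda>x. INF v\<in>{l..u}. c * v + g (x + v))"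
proof (rule convex_onI)
  fix t x y :: real
  assume t: "0 < t" "t < 1"
  note m = is_min_on_INF_shift[OF assms, of c]
  obtain a where a: "a \<in> {l..u}" "(INF v\<in>{l..u}. c * v + g (x + v)) = c * a + g (x + a)"
    using m[of x] by (rule is_min_onE)
  obtain b where b: "b \<in> {l..u}" "(INF v\<in>{l..u}. c * v + g (y + v)) = c * b + g (y + b)"
    using m[of y] by (rule is_min_onE)
  define v where "v = (1 - t) *\<^sub>R a + t *\<^sub>R b"
  have "v \<in> {l..u}"
    unfolding v_def using a(1) b(1) t by (intro convexD[OF convex_real_interval(5)]) auto
  then have "(INF v\<in>{l..u}. c * v + g (((1 - t) *\<^sub>R x + t *\<^sub>R y) + v))
      \<le> c * v + g (((1 - t) *\<^sub>R x + t *\<^sub>R y) + v)"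
    using m[of "(1 - t) *\<^sub>R x + t *\<^sub>R y"] unfolding is_min_on_def by (elim conjE bspec)
  also have "((1 - t) *\<^sub>R x + t *\<^sub>R y) + v = (1 - t) *\<^sub>R (x + a) + t *\<^sub>R (y + b)"
    by (simp add: v_def algebra_simps)
  also have "g \<dots> \<le> (1 - t) * g (x + a) + t * g (y + b)"
    using assms(2) t by (intro convex_onD) auto
  also have "c * v + \<dots> = (1 - t) * (c * a + g (x + a)) + t * (c * b + g (y + b))"
    by (simp add: v_def algebra_simps)
  finally show "(INF v\<in>{l..u}. c * v + g (((1 - t) *\<^sub>R x + t *\<^sub>R y) + v))
      \<le> (1 - t) * (INF v\<in>{l..u}. c * v + g (x + v)) + t * (INF v\<in>{l..u}. c * v + g (y + v))"
    using a(2) b(2) by simp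
qed simp

lemma convex_on_opt_value:
  assumes "\<forall>k\<in>{1..T}. L k \<le> U k \<and> compact (W k) \<and> W k \<noteq> {} \<and> convex_on UNIV (h k)"
    and "k \<ge> 1"
  shows "convex_on UNIV (opt_value T c L U W h k)"
  using assms(2)
proof (induction "Suc T - k" arbitrary: k)
  case 0
  then have "k > T" by simp
  then have "opt_value T c L U W h k = (\<lambda>x. 0)"
    by (simp add: fun_eq_iff opt_value.simps[of T c L U W h k])
  then show ?case by (simp add: convex_on_def)
next
  case (Suc n)
  then have k: "k \<in> {1..T}" by auto
  have "convex_on UNIV (opt_value T c L U W h (Suc k))"
    using Suc by (intro Suc.hyps(1)) auto
  then have "convex_on UNIV (\<lambda>y. h k y + opt_value T c L U W h (Suc k) y)"
    using assms(1) k by (intro convex_on_add) auto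
  then have "convex_on UNIV
      (\<lambda>y. SUP w\<in>W k. h k (y + w) + opt_value T c L U W h (Suc k) (y + w))"
    using assms(1) k by (intro convex_on_SUP_shift) auto
  then have "convex_on UNIV (\<lambda>x. INF u\<in>{L k..U k}. c k * u +
      (SUP w\<in>W k. h k (x + u + w) + opt_value T c L U W h (Suc k) (x + u + w)))"
    using assms(1) k by (intro convex_on_INF_shift) auto
  moreover have "opt_value T c L U W h k = (\<lambda>x. INF u\<in>{L k..U k}. c k * u +
      (SUP w\<in>W k. h k (x + u + w) + opt_value T c L U W h (Suc k) (x + u + w)))"
    using k by (auto simp: fun_eq_iff opt_value.simps[of T c L U W h k])
  ultimately show ?case by simp
qed

lemma opt_value_attained:
  fixes T :: nat and c L U :: "nat \<Rightarrow> real" and W :: "nat \<Rightarrow> real set"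
    and h :: "nat \<Rightarrow> real \<Rightarrow> real" and k :: nat
  assumes "\<forall>k\<in>{1..T}. L k \<le> U k \<and> compact (W k) \<and> W k \<noteq> {} \<and> convex_on UNIV (h k)"
    and k: "k \<in> {1..T}"
  defines "J \<equiv> opt_value T c L U W h"
  defines "M \<equiv> \<lambda>y. SUP w\<in>W k. h k (y + w) + J (Suc k) (y + w)"
  shows "is_max_on (\<lambda>w. h k (y + w) + J (Suc k) (y + w)) (W k) (M y)"
    and "is_min_on (\<lambda>u. c k * u + M (x + u)) {L k..U k} (J k x)"
proof -
  have "convex_on UNIV (\<lambda>y. h k y + J (Suc k) y)"
    using assms(1) k unfolding J_def by (intro convex_on_add convex_on_opt_value) auto
  then have max: "is_max_on (\<lambda>w. h k (y + w) + J (Suc k) (y + w)) (W k) (M y)"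
    and cvx: "convex_on UNIV M" for y
    using assms(1) k unfolding M_def
    by (auto intro!: is_max_on_SUP_shift convex_on_SUP_shift)
  show "is_max_on (\<lambda>w. h k (y + w) + J (Suc k) (y + w)) (W k) (M y)" by (rule max)
  have "J k x = (INF u\<in>{L k..U k}. c k * u + M (x + u))"
    using k by (simp add: J_def M_def opt_value.simps[of T c L U W h k])
  then show "is_min_on (\<lambda>u. c k * u + M (x + u)) {L k..U k} (J k x)"
    using is_min_on_INF_shift[OF _ cvx] assms(1) k by simp
qed

end

theory Submission
  imports Defs
begin

text \<open>
  By forward induction on the stage, the accumulated cost \<open>s\<close> and the state \<open>x\<close> are affine
  functions of the disturbances, which range over a box, with \<open>s + J\<^sub>k(x) \<le> J\<^sub>1(x\<^sub>1)\<close>; it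
  suffices to preserve this bound, since a greedy adversary always attains equality.

  Control: after replacing \<open>s\<close> by \<open>s - c\<^sub>k x\<close>, every point of the box admits some
  \<open>u \<in> [L, U]\<close> with \<open>s + F(x + u) \<le> M\<close> for a convex \<open>F\<close>, and an affine selection \<open>q\<close> is
  needed. Start at the vertex maximising \<open>s\<close> and let \<open>x + q\<close> move along each edge in the same
  direction as \<open>x\<close>, no further than \<open>x\<close>, and by at most a common multiple (one for increasing, one
  for decreasing edges) of the loss in \<open>s\<close>, chosen such that \<open>q\<close> just exhausts \<open>[L, U]\<close>. The
  bound is then verified against each subgradient of \<open>F\<close>: the corresponding linear functional is
  maximal over the box either at the initial vertex or at one where \<open>q\<close> is at an end of \<open>[L, U]\<close>.

  Cost: with all edges oriented so that \<open>x\<close> increases, \<open>h(x)\<close> is supermodular and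
  \<open>M - s - J\<^sub>k\<^sub>+\<^sub>1(x)\<close> is submodular on the vertices, so Frank's discrete sandwich theorem
  separates them by a modular, that is affine, function \<open>z\<close>; convexity extends the bounds to the box.
\<close>

section \<open>Affine running costs\<close>

text \<open>By induction on the ground set: a weight \<open>t\<close> is fixed for the new element
  \<open>j\<close>, and \<open>f\<close> and \<open>g\<close> are projected to \<open>I\<close> by
  optimising over whether \<open>j\<close> is taken.\<close>

lemma modular_sandwich:
  fixes f g :: "'a set \<Rightarrow> real"
  assumes "finite I"
    and "\<And>A B. A \<subseteq> I \<Longrightarrow> B \<subseteq> I \<Longrightarrow> f A + f B \<le> f (A \<union> B) + f (A \<inter> B)"
    and "\<And>A B. A \<subseteq> I \<Longrightarrow> B \<subseteq> I \<Longrightarrow> g (A \<union> B) + g (A \<inter> B) \<le> g A + g B"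
    and "\<And>A. A \<subseteq> I \<Longrightarrow> f A \<le> g A"
  shows "\<exists>m0 m. \<forall>A\<subseteq>I. f A \<le> m0 + sum m A \<and> m0 + sum m A \<le> g A"
  using assms
proof (induction I arbitrary: f g rule: finite_induct)
  case empty
  then have "f {} \<le> g {}" by simp
  then have "\<forall>A\<subseteq>{}. f A \<le> f {} + sum (\<lambda>_. 0) A \<and> f {} + sum (\<lambda>_. 0) A \<le> g A" by auto
  then show ?case by blast
next
  case (insert j I)
  note super = insert.prems(1) and sub = insert.prems(2) and le = insert.prems(3)
  \<comment> \<open>Staying below \<open>g\<close> on \<open>S\<close> and above \<open>f\<close> on
    \<open>insert j S\<close> forces the weight of \<open>j\<close> to be at least
    \<open>f (insert j S) - g S\<close>; \<open>t\<close> is the largest of these lower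
    bounds.\<close>
  define t where "t = Max ((\<lambda>S. f (insert j S) - g S) ` Pow I)"
  have t1: "f (insert j S) - g S \<le> t" if "S \<subseteq> I" for S
    unfolding t_def using insert.hyps(1) that by (intro Max_ge) auto
  have "t \<in> (\<lambda>S. f (insert j S) - g S) ` Pow I"
    unfolding t_def using insert.hyps(1) by (intro Max_in) auto
  then obtain S where S: "S \<subseteq> I" "t = f (insert j S) - g S" by auto
  \<comment> \<open>Uncrossing: as \<open>j\<close> lies outside \<open>I\<close>, the pairs
    \<open>insert j S\<close>, \<open>R\<close> and \<open>S\<close>, \<open>insert j R\<close> have
    the same union and intersection, so supermodularity of \<open>f\<close>,
    \<open>f \<le> g\<close> and submodularity of \<open>g\<close> chain together.\<close>
  have t2: "t \<le> g (insert j R) - f R" if R: "R \<subseteq> I" for R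
  proof -
    have eq: "insert j S \<union> R = insert j (S \<union> R)" "insert j S \<inter> R = S \<inter> R"
      "S \<union> insert j R = insert j (S \<union> R)" "S \<inter> insert j R = S \<inter> R"
      using insert.hyps(2) S(1) R by auto
    have "f (insert j S) + f R \<le> f (insert j (S \<union> R)) + f (S \<inter> R)"
      using super[of "insert j S" R] S(1) R eq by auto
    also have "\<dots> \<le> g (insert j (S \<union> R)) + g (S \<inter> R)"
      using S(1) R by (intro add_mono le) auto
    also have "\<dots> \<le> g S + g (insert j R)"
      using sub[of S "insert j R"] S(1) R eq by auto
    finally show ?thesis using S(2) by simp
  qed
  \<comment> \<open>Optimising over the membership of \<open>j\<close> preserves super- and submodularity.\<close>
  define f' where "f' A = max (f A) (f (insert j A) - t)" for A
  define g' where "g' A = min (g A) (g (insert j A) - t)" for A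
  have ins: "insert j A \<union> B = insert j (A \<union> B)" "A \<union> insert j B = insert j (A \<union> B)"
    "insert j A \<inter> B = A \<inter> B" "A \<inter> insert j B = A \<inter> B"
    "insert j A \<inter> insert j B = insert j (A \<inter> B)" if "A \<subseteq> I" "B \<subseteq> I" for A B
    using that insert.hyps(2) by auto
  have "\<exists>m0 m. \<forall>A\<subseteq>I. f' A \<le> m0 + sum m A \<and> m0 + sum m A \<le> g' A"
  proof (rule insert.IH)
    fix A B assume AB: "A \<subseteq> I" "B \<subseteq> I"
    then have sb: "A \<subseteq> insert j I" "B \<subseteq> insert j I" "insert j A \<subseteq> insert j I" "insert j B \<subseteq> insert j I"
      by auto
    \<comment> \<open>The two maxima on the left give four cases. In each, as many sets contain
      \<open>j\<close> on the right as on the left, so the multiples of \<open>t\<close>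
      cancel.\<close>
    show "f' A + f' B \<le> f' (A \<union> B) + f' (A \<inter> B)"
      using super[OF sb(1,2)] super[OF sb(3,2)] super[OF sb(1,4)] super[OF sb(3,4)]
      unfolding f'_def ins[OF AB] Un_insert_left Un_insert_right insert_absorb2 by linarith
    show "g' (A \<union> B) + g' (A \<inter> B) \<le> g' A + g' B"
      using sub[OF sb(1,2)] sub[OF sb(3,2)] sub[OF sb(1,4)] sub[OF sb(3,4)]
      unfolding g'_def ins[OF AB] Un_insert_left Un_insert_right insert_absorb2 by linarith
  next
    fix A assume A: "A \<subseteq> I"
    then have "f A \<le> g A" "f (insert j A) \<le> g (insert j A)" by (auto intro!: le)
    with t1[OF A] t2[OF A] show "f' A \<le> g' A" unfolding f'_def g'_def by linarith
  qed
  then obtain m0 m where m: "\<And>A. A \<subseteq> I \<Longrightarrow> f' A \<le> m0 + sum m A \<and> m0 + sum m A \<le> g' A"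
    by blast
  \<comment> \<open>The bounds for \<open>f'\<close> and \<open>g'\<close> at \<open>A - {j}\<close>
    serve both cases: their first entries if \<open>j\<close> is not in \<open>A\<close>, their
    second entries if it is.\<close>
  have "f A \<le> m0 + sum (m(j := t)) A \<and> m0 + sum (m(j := t)) A \<le> g A" if A: "A \<subseteq> insert j I" for A
  proof -
    have sm: "sum (m(j := t)) (A - {j}) = sum m (A - {j})" by (intro sum.cong) auto
    have "finite A" using A insert.hyps(1) by (meson finite.insertI finite_subset)
    have sub': "A - {j} \<subseteq> I" using A by auto
    show ?thesis
    proof (cases "j \<in> A")
      case True
      then have "sum (m(j := t)) A = t + sum m (A - {j})"
        using sum.remove[OF \<open>finite A\<close> True, of "m(j := t)"] sm by simp
      moreover have "insert j (A - {j}) = A" using True by auto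
      ultimately show ?thesis using m[OF sub'] unfolding f'_def g'_def by auto
    next
      case False
      then have "A - {j} = A" by auto
      then show ?thesis using m[OF sub'] sm unfolding f'_def g'_def by auto
    qed
  qed
  then show ?case by blast
qed

text \<open>Both \<open>x + a\<close> and \<open>x + b\<close> are convex combinations of
  \<open>x\<close> and \<open>x + a + b\<close>, with complementary weights; the two convexity
  inequalities are added.\<close>

lemma convex_on_supermodular_real:
  fixes G :: "real \<Rightarrow> real"
  assumes "convex_on UNIV G" "0 \<le> a" "0 \<le> b"
  shows "G (x + a) + G (x + b) \<le> G (x + a + b) + G x"
proof (cases "a + b = 0")
  case True
  with assms have "a = 0" "b = 0" by auto
  then show ?thesis by simp
next
  case False
  with assms have pos: "a + b > 0" by auto
  define s where "s = a / (a + b)"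
  have s: "0 \<le> s" "s \<le> 1" using assms pos unfolding s_def by (auto simp: field_simps)
  have sa: "s * (a + b) = a" using pos unfolding s_def by simp
  have e1: "(1 - s) *\<^sub>R x + s *\<^sub>R (x + a + b) = x + a"
    using sa by (simp add: algebra_simps)
  have e2: "(1 - (1 - s)) *\<^sub>R x + (1 - s) *\<^sub>R (x + a + b) = x + b"
    using sa by (simp add: algebra_simps)
  have "G (x + a) \<le> (1 - s) * G x + s * G (x + a + b)"
    using convex_onD[OF assms(1) s, of x "x + a + b"] e1 by simp
  moreover have "G (x + b) \<le> s * G x + (1 - s) * G (x + a + b)"
    using convex_onD[OF assms(1), of "1 - s" x "x + a + b"] s e2 by simp
  ultimately show ?thesis by (simp add: algebra_simps)
qed

text \<open>Along one coordinate, with the others fixed, the left side is convex and the right side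
  affine, so the two ends suffice. The constants \<open>x0\<close> and \<open>e0\<close> vary in the
  induction to absorb \<open>d j\<close> and \<open>e j\<close> at the end
  \<open>v j = 1\<close>.\<close>

lemma convex_le_on_cube_if_le_on_vertices:
  fixes G :: "real \<Rightarrow> real"
  assumes "finite I" "convex_on UNIV G"
    and "\<And>S. S \<subseteq> I \<Longrightarrow> G (x0 + sum d S) \<le> e0 + sum e S"
    and "\<forall>i\<in>I. 0 \<le> v i \<and> v i \<le> 1"
  shows "G (x0 + (\<Sum>i\<in>I. d i * v i)) \<le> e0 + (\<Sum>i\<in>I. e i * v i)"
  using assms(1,3,4)
proof (induction I arbitrary: x0 e0 rule: finite_induct)
  case empty
  then show ?case using empty(1)[of "{}"] by simp
next
  case (insert j I)
  define A where "A = x0 + (\<Sum>i\<in>I. d i * v i)"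
  define B where "B = e0 + (\<Sum>i\<in>I. e i * v i)"
  have v: "0 \<le> v j" "v j \<le> 1" using insert.prems by auto
  have "G (x0 + (\<Sum>i\<in>I. d i * v i)) \<le> e0 + (\<Sum>i\<in>I. e i * v i)"
    using insert.prems by (intro insert.IH) auto
  then have GA: "G A \<le> B" unfolding A_def B_def .
  have "G ((x0 + d j) + (\<Sum>i\<in>I. d i * v i)) \<le> (e0 + e j) + (\<Sum>i\<in>I. e i * v i)"
  proof (rule insert.IH)
    fix S assume S: "S \<subseteq> I"
    then have "finite S" "j \<notin> S" using insert.hyps finite_subset by auto
    then show "G (x0 + d j + sum d S) \<le> e0 + e j + sum e S"
      using insert.prems(1)[of "insert j S"] S by (simp add: add.assoc subset_insertI2)
  qed (use insert.prems in auto)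
  then have GB: "G (A + d j) \<le> B + e j" unfolding A_def B_def by (simp add: algebra_simps)
  have "G (A + d j * v j) \<le> (1 - v j) * G A + v j * G (A + d j)"
    using convex_onD[OF assms(2) v, of A "A + d j"] by (simp add: algebra_simps)
  also have "\<dots> \<le> (1 - v j) * B + v j * (B + e j)"
    using GA GB v by (intro add_mono mult_left_mono) auto
  also have "\<dots> = B + e j * v j" by (simp add: algebra_simps)
  finally show ?case using insert.hyps unfolding A_def B_def by (simp add: algebra_simps)
qed

text \<open>A vertex is encoded by the set of coordinates equal to 1. After separation on the
  vertices, the two bounds on the cost extend to the cube independently, each placing a convex
  function below an affine one.\<close>

lemma affine_cost_cube:
  fixes h J :: "real \<Rightarrow> real" and a d :: "'a \<Rightarrow> real"
  assumes fin: "finite I" and h: "convex_on UNIV h" and J: "convex_on UNIV J"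
    and d: "\<And>i. i \<in> I \<Longrightarrow> 0 \<le> d i"
    and le: "\<And>v. \<forall>i\<in>I. 0 \<le> v i \<and> v i \<le> 1 \<Longrightarrow>
      s0 + (\<Sum>i\<in>I. a i * v i) + h (x0 + (\<Sum>i\<in>I. d i * v i)) + J (x0 + (\<Sum>i\<in>I. d i * v i)) \<le> M"
  shows "\<exists>z0 z. \<forall>v. (\<forall>i\<in>I. 0 \<le> v i \<and> v i \<le> 1) \<longrightarrow>
      h (x0 + (\<Sum>i\<in>I. d i * v i)) \<le> z0 + (\<Sum>i\<in>I. z i * v i) \<and>
      s0 + (\<Sum>i\<in>I. a i * v i) + (z0 + (\<Sum>i\<in>I. z i * v i)) + J (x0 + (\<Sum>i\<in>I. d i * v i)) \<le> M"
proof -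
  \<comment> \<open>Relative to \<open>A \<inter> B\<close>, the differences \<open>A - B\<close>
    and \<open>B - A\<close> contribute two nonnegative increments, and their sum leads to
    \<open>A \<union> B\<close>.\<close>
  have super: "G (x0 + sum d A) + G (x0 + sum d B) \<le> G (x0 + sum d (A \<union> B)) + G (x0 + sum d (A \<inter> B))"
    if G: "convex_on UNIV G" and AB: "A \<subseteq> I" "B \<subseteq> I" for A B and G :: "real \<Rightarrow> real"
  proof -
    have f: "finite A" "finite B" using AB fin finite_subset by auto
    have sA: "sum d A = sum d (A \<inter> B) + sum d (A - B)"
      by (rule sum.Int_Diff[OF f(1)])
    have sU: "sum d (A \<union> B) = sum d (A \<inter> B) + sum d (A - B) + sum d (B - A)"
      using sum.union_diff2[OF f, of d] by simp
    have sB: "sum d B = sum d (A \<inter> B) + sum d (B - A)" using sum.Int_Diff[OF f(2), of d A] by (simp add: Int_commute)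
    have nn: "0 \<le> sum d (A - B)" "0 \<le> sum d (B - A)" using AB d by (auto intro!: sum_nonneg)
    show ?thesis
      using convex_on_supermodular_real[OF G nn, of "x0 + sum d (A \<inter> B)"]
      unfolding sU sB sA by (simp add: add.assoc)
  qed
  have sum_mod: "sum a (A \<union> B) + sum a (A \<inter> B) = sum a A + sum a B" if "A \<subseteq> I" "B \<subseteq> I" for A B
    using that fin finite_subset by (metis sum.union_inter)
  have "\<exists>m0 m. \<forall>A\<subseteq>I. h (x0 + sum d A) \<le> m0 + sum m A \<and>
      m0 + sum m A \<le> M - (s0 + sum a A) - J (x0 + sum d A)"
  proof (rule modular_sandwich[OF fin super[OF h]])
    fix A B assume AB: "A \<subseteq> I" "B \<subseteq> I"
    show "M - (s0 + sum a (A \<union> B)) - J (x0 + sum d (A \<union> B)) +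
        (M - (s0 + sum a (A \<inter> B)) - J (x0 + sum d (A \<inter> B)))
      \<le> M - (s0 + sum a A) - J (x0 + sum d A) + (M - (s0 + sum a B) - J (x0 + sum d B))"
      using super[OF J AB] sum_mod[OF AB] by linarith
  next
    fix A assume A: "A \<subseteq> I"
    have "(\<Sum>i\<in>I. r i * (if i \<in> A then 1 else 0)) = sum r A" for r :: "'a \<Rightarrow> real"
      using sum.inter_restrict[OF fin, of r A] A by (simp add: if_distrib Int_absorb1 cong: if_cong)
    moreover have "\<forall>i\<in>I. (0::real) \<le> (if i \<in> A then 1 else 0) \<and> (if i \<in> A then 1 else 0) \<le> (1::real)"
      by simp
    ultimately show "h (x0 + sum d A) \<le> M - (s0 + sum a A) - J (x0 + sum d A)"
      using le[of "\<lambda>i. if i \<in> A then 1 else 0"] by simp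
  qed
  then obtain m0 m where m: "\<And>A. A \<subseteq> I \<Longrightarrow> h (x0 + sum d A) \<le> m0 + sum m A"
      "\<And>A. A \<subseteq> I \<Longrightarrow> m0 + sum m A \<le> M - (s0 + sum a A) - J (x0 + sum d A)" by blast
  have "h (x0 + (\<Sum>i\<in>I. d i * v i)) \<le> m0 + (\<Sum>i\<in>I. m i * v i) \<and>
      s0 + (\<Sum>i\<in>I. a i * v i) + (m0 + (\<Sum>i\<in>I. m i * v i)) + J (x0 + (\<Sum>i\<in>I. d i * v i)) \<le> M"
    if v: "\<forall>i\<in>I. 0 \<le> v i \<and> v i \<le> 1" for v
  proof
    show "h (x0 + (\<Sum>i\<in>I. d i * v i)) \<le> m0 + (\<Sum>i\<in>I. m i * v i)"
      by (rule convex_le_on_cube_if_le_on_vertices[OF fin h m(1) v])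
    \<comment> \<open>The upper bound on the cost is read as an affine upper bound on the convex
      function \<open>J\<close>.\<close>
    have "J (x0 + sum d A) \<le> (M - s0 - m0) + sum (\<lambda>i. - a i - m i) A" if "A \<subseteq> I" for A
      using m(2)[OF that] by (simp add: sum_subtractf sum_negf)
    from convex_le_on_cube_if_le_on_vertices[OF fin J this v]
    show "s0 + (\<Sum>i\<in>I. a i * v i) + (m0 + (\<Sum>i\<in>I. m i * v i)) + J (x0 + (\<Sum>i\<in>I. d i * v i)) \<le> M"
      by (simp add: algebra_simps sum_subtractf sum_negf sum.distrib)
  qed
  then show ?thesis by blast
qed

section \<open>Affine controls\<close>

text \<open>On edge \<open>i\<close>, \<open>b i\<close> is the growth of the state,
  \<open>\<alpha> i\<close> the loss in accumulated cost and \<open>y i\<close> the growth left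
  after control; \<open>D\<close> is the room for lowering the control. Generically
  \<open>y i = min (b i) (\<tau> * \<alpha> i)\<close>, with the level \<open>\<tau>\<close>
  spending \<open>D\<close> exactly. A slope \<open>\<mu>\<close> then falls under the first or the
  second alternative according to whether \<open>\<mu> * \<tau> \<le> 1\<close>.\<close>

lemma water_filling:
  fixes b \<alpha> :: "'a \<Rightarrow> real"
  assumes fin: "finite P" and b: "\<And>i. i \<in> P \<Longrightarrow> 0 \<le> b i" and \<alpha>: "\<And>i. i \<in> P \<Longrightarrow> 0 \<le> \<alpha> i" and D: "0 \<le> D"
  obtains y where "\<And>i. i \<in> P \<Longrightarrow> 0 \<le> y i \<and> y i \<le> b i"
    and "(\<Sum>i\<in>P. b i - y i) \<le> D"
    and "\<And>\<mu>. 0 \<le> \<mu> \<Longrightarrow> (\<forall>i\<in>P. \<mu> * y i \<le> \<alpha> i) \<or>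
      (\<forall>i\<in>P. y i < b i \<longrightarrow> \<alpha> i \<le> \<mu> * y i) \<and> (\<Sum>i\<in>P. b i - y i) = D"
proof -
  define Z where "Z = {i \<in> P. \<alpha> i = 0}"
  have Z: "Z \<subseteq> P" "finite Z" using fin unfolding Z_def by auto
  have sumZ: "0 \<le> sum b Z" using b Z by (intro sum_nonneg) auto
  \<comment> \<open>With rising level the total reduction falls from \<open>sum b P\<close> at level
    0 to \<open>sum b Z\<close>; the cases locate \<open>D\<close> relative to this range.\<close>
  consider "sum b P < D" | "D \<le> sum b Z" | "sum b Z < D" "D \<le> sum b P" by linarith
  then show ?thesis
  proof cases
    case 1
    \<comment> \<open>The room exceeds the whole growth, which can be cancelled; the first
      alternative then holds for every slope.\<close>
    then show ?thesis using b \<alpha> by (intro that[of "\<lambda>_. 0"]) auto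
  next
    case 2
    \<comment> \<open>The limit case of infinite level: only the summands with \<open>\<alpha> i = 0\<close> are shrunk.\<close>
    define \<theta> where "\<theta> = (if sum b Z = 0 then 1 else 1 - D / sum b Z)"
    \<comment> \<open>If \<open>sum b Z = 0\<close>, then \<open>D = 0\<close> in this case, so the
      default factor 1 also spends exactly \<open>D\<close>.\<close>
    have \<theta>: "0 \<le> \<theta>" "\<theta> \<le> 1" "(1 - \<theta>) * sum b Z = D"
      using 2 D sumZ unfolding \<theta>_def by (auto simp: field_simps)
    define y where "y i = (if i \<in> Z then \<theta> * b i else b i)" for i
    have "(\<Sum>i\<in>P. b i - y i) = (\<Sum>i\<in>Z. b i - y i)"
      using fin Z by (intro sum.mono_neutral_right) (auto simp: y_def)
    also have "\<dots> = (\<Sum>i\<in>Z. (1 - \<theta>) * b i)" by (intro sum.cong) (auto simp: y_def algebra_simps)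
    also have "\<dots> = D" using \<theta>(3) by (simp add: sum_distrib_left)
    finally have S: "(\<Sum>i\<in>P. b i - y i) = D" .
    show ?thesis
    proof (rule that[of y])
      show "0 \<le> y i \<and> y i \<le> b i" if "i \<in> P" for i
        using b[OF that] \<theta> by (auto simp: y_def mult_left_le_one_le)
      show "(\<Sum>i\<in>P. b i - y i) \<le> D" using S by simp
      fix \<mu> :: real assume \<mu>: "0 \<le> \<mu>"
      \<comment> \<open>Only members of \<open>Z\<close> are shrunk, and there
        \<open>\<alpha> i = 0\<close>, so the second alternative holds for every slope.\<close>
      have "\<alpha> i \<le> \<mu> * y i" if "i \<in> P" "y i < b i" for i
      proof -
        have "i \<in> Z" using that by (auto simp: y_def split: if_splits)
        then show ?thesis using b[OF that(1)] \<theta> \<mu> by (auto simp: y_def Z_def)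
      qed
      then show "(\<forall>i\<in>P. \<mu> * y i \<le> \<alpha> i) \<or>
          (\<forall>i\<in>P. y i < b i \<longrightarrow> \<alpha> i \<le> \<mu> * y i) \<and> (\<Sum>i\<in>P. b i - y i) = D" using S by blast
    qed
  next
    case 3
    define f where "f \<tau> = (\<Sum>i\<in>P. b i - min (b i) (\<tau> * \<alpha> i))" for \<tau>
    \<comment> \<open>The sum dominates every single quotient, so at this level no summand with
      \<open>\<alpha> i > 0\<close> is reduced. Those with \<open>\<alpha> i = 0\<close> add 0, by
      the convention for division by zero.\<close>
    define \<tau>1 where "\<tau>1 = (\<Sum>i\<in>P. b i / \<alpha> i)"
    have \<tau>1: "0 \<le> \<tau>1" unfolding \<tau>1_def using b \<alpha> by (intro sum_nonneg) auto
    have "f 0 = sum b P" unfolding f_def using b by (intro sum.cong) auto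
    moreover have "f \<tau>1 = sum b Z"
    proof -
      have "b i - min (b i) (\<tau>1 * \<alpha> i) = 0" if i: "i \<in> P - Z" for i
      proof -
        have "\<alpha> i > 0" using i \<alpha>[of i] unfolding Z_def by (auto simp: less_le)
        moreover have "b i / \<alpha> i \<le> \<tau>1"
          unfolding \<tau>1_def using i fin b \<alpha> by (intro member_le_sum) auto
        ultimately show ?thesis by (simp add: field_simps)
      qed
      then have "f \<tau>1 = (\<Sum>i\<in>Z. b i - min (b i) (\<tau>1 * \<alpha> i))"
        unfolding f_def using fin Z by (intro sum.mono_neutral_right) auto
      also have "\<dots> = sum b Z" using b Z by (intro sum.cong) (auto simp: Z_def)
      finally show ?thesis .
    qed
    moreover have "continuous_on {0..\<tau>1} f"
      unfolding f_def by (intro continuous_intros)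
    ultimately obtain \<tau> where \<tau>: "0 \<le> \<tau>" "f \<tau> = D"
      using IVT2'[of f \<tau>1 D 0] 3 \<tau>1 by auto
    define y where "y i = min (b i) (\<tau> * \<alpha> i)" for i
    have S: "(\<Sum>i\<in>P. b i - y i) = D" using \<tau>(2) unfolding f_def y_def .
    show ?thesis
    proof (rule that[of y])
      show "0 \<le> y i \<and> y i \<le> b i" if "i \<in> P" for i
        using b[OF that] \<alpha>[OF that] \<tau> by (auto simp: y_def)
      show "(\<Sum>i\<in>P. b i - y i) \<le> D" using S by simp
      fix \<mu> :: real assume \<mu>: "0 \<le> \<mu>"
      show "(\<forall>i\<in>P. \<mu> * y i \<le> \<alpha> i) \<or>
          (\<forall>i\<in>P. y i < b i \<longrightarrow> \<alpha> i \<le> \<mu> * y i) \<and> (\<Sum>i\<in>P. b i - y i) = D"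
      proof (cases "\<mu> * \<tau> \<le> 1")
        case True
        have "\<mu> * y i \<le> \<alpha> i" if "i \<in> P" for i
        proof -
          have "\<mu> * y i \<le> \<mu> * (\<tau> * \<alpha> i)" using \<mu> by (intro mult_left_mono) (auto simp: y_def)
          also have "\<dots> = (\<mu> * \<tau>) * \<alpha> i" by simp
          also have "\<dots> \<le> 1 * \<alpha> i" using True \<alpha>[OF that] by (intro mult_right_mono) auto
          finally show ?thesis by simp
        qed
        then show ?thesis by blast
      next
        case False
        have "\<alpha> i \<le> \<mu> * y i" if "i \<in> P" "y i < b i" for i
        proof -
          have "1 * \<alpha> i \<le> (\<mu> * \<tau>) * \<alpha> i" using False \<alpha>[OF that(1)] by (intro mult_right_mono) auto
          moreover have "y i = \<tau> * \<alpha> i" using that(2) by (auto simp: y_def min_def split: if_splits)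
          ultimately show ?thesis by simp
        qed
        then show ?thesis using S by blast
      qed
    qed
  qed
qed

text \<open>The subgradient inequality at the state reached from \<open>v\<close> reduces the bound
  to the linear functional \<open>\<mu> * B v - A v\<close>. Under the first alternative it is at
  most 0, and \<open>v\<close> is compared with the origin; under the second, \<open>v\<close> is
  compared with a vertex where the affine control equals \<open>L\<close>. Since
  \<open>\<mu> \<ge> 0\<close>, a feasible control above \<open>L\<close> at that vertex only
  strengthens the comparison; the upper end is treated by reflection.\<close>

lemma affine_control_bound_at_subgradient:
  fixes F :: "real \<Rightarrow> real" and \<alpha> \<beta> Y :: "'a \<Rightarrow> real"
  assumes fin: "finite I" and \<mu>: "0 \<le> \<mu>"
    and pos: "\<And>i. i \<in> I \<Longrightarrow> 0 < \<beta> i \<Longrightarrow> Y i \<le> \<beta> i"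
    and neg: "\<And>i. i \<in> I \<Longrightarrow> \<beta> i \<le> 0 \<Longrightarrow> Y i \<le> 0"
    and \<alpha>: "\<And>i. i \<in> I \<Longrightarrow> 0 \<le> \<alpha> i"
    and level: "(\<forall>i\<in>{i\<in>I. 0 < \<beta> i}. \<mu> * Y i \<le> \<alpha> i) \<or>
      (\<forall>i\<in>{i\<in>I. 0 < \<beta> i}. Y i < \<beta> i \<longrightarrow> \<alpha> i \<le> \<mu> * Y i) \<and>
      (\<Sum>i\<in>{i\<in>I. 0 < \<beta> i}. \<beta> i - Y i) = u0 - L"
    and origin: "s0 + F (x0 + u0) \<le> M"
    and feas: "\<And>v. \<forall>i\<in>I. 0 \<le> v i \<and> v i \<le> 1 \<Longrightarrow>
      \<exists>u\<ge>L. s0 - (\<Sum>i\<in>I. \<alpha> i * v i) + F (x0 + (\<Sum>i\<in>I. \<beta> i * v i) + u) \<le> M"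
    and v: "\<forall>i\<in>I. 0 \<le> v i \<and> v i \<le> 1"
    and sg: "\<And>t. F (x0 + u0 + (\<Sum>i\<in>I. Y i * v i)) + \<mu> * (t - (x0 + u0 + (\<Sum>i\<in>I. Y i * v i))) \<le> F t"
  shows "s0 - (\<Sum>i\<in>I. \<alpha> i * v i) + F (x0 + u0 + (\<Sum>i\<in>I. Y i * v i)) \<le> M"
proof -
  define A where "A v = (\<Sum>i\<in>I. \<alpha> i * v i)" for v
  define B where "B v = (\<Sum>i\<in>I. Y i * v i)" for v
  have gap: "\<mu> * B v - A v = (\<Sum>i\<in>I. (\<mu> * Y i - \<alpha> i) * v i)" for v
    unfolding A_def B_def by (simp add: sum_distrib_left sum_subtractf algebra_simps)
  have neg': "(\<mu> * Y i - \<alpha> i) * r \<le> 0" if "i \<in> I" "\<beta> i \<le> 0" "0 \<le> r" for i r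
    using neg[OF that(1,2)] \<alpha>[OF that(1)] \<mu> that(3)
    by (intro mult_nonpos_nonneg) (auto intro: order_trans[OF mult_nonneg_nonpos])
  note sg' = sg[folded B_def]
  from level show ?thesis
  proof
    assume small: "\<forall>i\<in>{i\<in>I. 0 < \<beta> i}. \<mu> * Y i \<le> \<alpha> i"
    have "(\<mu> * Y i - \<alpha> i) * v i \<le> 0" if i: "i \<in> I" for i
    proof (cases "0 < \<beta> i")
      case True
      then show ?thesis using small i v by (intro mult_nonpos_nonneg) auto
    next
      case False
      then show ?thesis using neg'[of i "v i"] i v by auto
    qed
    then have "\<mu> * B v - A v \<le> 0" unfolding gap by (intro sum_nonpos) auto
    moreover have "F (x0 + u0 + B v) \<le> F (x0 + u0) + \<mu> * B v"
      using sg'[of "x0 + u0"] by (simp add: algebra_simps)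
    ultimately show ?thesis using origin unfolding A_def B_def by linarith
  next
    assume large: "(\<forall>i\<in>{i\<in>I. 0 < \<beta> i}. Y i < \<beta> i \<longrightarrow> \<alpha> i \<le> \<mu> * Y i) \<and>
      (\<Sum>i\<in>{i\<in>I. 0 < \<beta> i}. \<beta> i - Y i) = u0 - L"
    \<comment> \<open>A vertex maximising \<open>\<mu> * B v - A v\<close> at which the control is at its lower bound \<open>L\<close>.\<close>
    define e :: "'a \<Rightarrow> real" where
      "e i = (if 0 < \<beta> i \<and> (Y i < \<beta> i \<or> \<alpha> i < \<mu> * Y i) then 1 else 0)" for i
    have e: "\<forall>i\<in>I. 0 \<le> e i \<and> e i \<le> 1" by (auto simp: e_def)
    have "(\<mu> * Y i - \<alpha> i) * v i \<le> (\<mu> * Y i - \<alpha> i) * e i" if i: "i \<in> I" for i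
    proof (cases "e i = 1")
      case True
      then have "0 \<le> \<mu> * Y i - \<alpha> i" using large i by (auto simp: e_def split: if_splits)
      then have "(\<mu> * Y i - \<alpha> i) * v i \<le> (\<mu> * Y i - \<alpha> i) * 1"
        using v i by (intro mult_left_mono) auto
      with True show ?thesis by simp
    next
      case False
      then have e0: "e i = 0" and c: "\<beta> i \<le> 0 \<or> \<mu> * Y i \<le> \<alpha> i"
        by (auto simp: e_def split: if_splits)
      have "(\<mu> * Y i - \<alpha> i) * v i \<le> 0"
      proof (cases "\<beta> i \<le> 0")
        case True
        then show ?thesis using neg'[of i "v i"] i v by auto
      next
        case False
        then show ?thesis using c i v by (intro mult_nonpos_nonneg) auto
      qed
      with e0 show ?thesis by simp
    qed
    then have max: "\<mu> * B v - A v \<le> \<mu> * B e - A e" unfolding gap by (intro sum_mono) auto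
    obtain u where u: "L \<le> u" "s0 - A e + F (x0 + (\<Sum>i\<in>I. \<beta> i * e i) + u) \<le> M"
      using feas[OF e] unfolding A_def by blast
    \<comment> \<open>All room for lowering the control is spent at \<open>e\<close>: on an
      increasing edge with \<open>e i = 0\<close>, assumption \<open>pos\<close> leaves
      \<open>Y i = \<beta> i\<close>, so the missing summand vanishes.\<close>
    have "(\<Sum>i\<in>I. \<beta> i * e i) - B e = (\<Sum>i\<in>I. (\<beta> i - Y i) * e i)"
      unfolding B_def by (simp add: sum_subtractf algebra_simps)
    also have "\<dots> = (\<Sum>i\<in>{i\<in>I. 0 < \<beta> i}. (\<beta> i - Y i) * e i)"
      using fin by (intro sum.mono_neutral_right) (auto simp: e_def)
    also have "\<dots> = (\<Sum>i\<in>{i\<in>I. 0 < \<beta> i}. \<beta> i - Y i)"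
    proof (intro sum.cong refl)
      fix i assume "i \<in> {i\<in>I. 0 < \<beta> i}"
      then show "(\<beta> i - Y i) * e i = \<beta> i - Y i" using pos[of i] by (auto simp: e_def)
    qed
    finally have "(\<Sum>i\<in>I. \<beta> i * e i) = B e + u0 - L" using large by simp
    then have "x0 + (\<Sum>i\<in>I. \<beta> i * e i) + u = x0 + u0 + B e + (u - L)" by simp
    then have "s0 - A e + F (x0 + u0 + B e + (u - L)) \<le> M" using u(2) by (simp only:)
    \<comment> \<open>The subgradient inequality, evaluated at the state which the feasible control
      \<open>u\<close> reaches from \<open>e\<close>.\<close>
    moreover have "F (x0 + u0 + B v) + \<mu> * (B e - B v + (u - L)) \<le> F (x0 + u0 + B e + (u - L))"
      using sg'[of "x0 + u0 + B e + (u - L)"] by (simp add: algebra_simps)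
    moreover have "\<mu> * (B e - B v + (u - L)) = \<mu> * B e - \<mu> * B v + \<mu> * (u - L)"
      by (simp add: algebra_simps)
    moreover have "0 \<le> \<mu> * (u - L)" using \<mu> u(1) by simp
    ultimately show ?thesis using max unfolding A_def[symmetric] B_def[symmetric] by linarith
  qed
qed

text \<open>As \<open>\<alpha>\<close> is nonnegative, the origin is the vertex of greatest
  accumulated cost. From a feasible control \<open>u0\<close> there, increasing edges may lower the
  control by \<open>u0 - L\<close> in total and decreasing edges may raise it by
  \<open>U - u0\<close>; each budget is distributed by water filling.\<close>

lemma affine_control_cube:
  fixes F :: "real \<Rightarrow> real" and \<alpha> \<beta> :: "'a \<Rightarrow> real"
  assumes fin: "finite I" and F: "convex_on UNIV F"
    and \<alpha>: "\<And>i. i \<in> I \<Longrightarrow> 0 \<le> \<alpha> i"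
    and feas: "\<And>v. \<forall>i\<in>I. 0 \<le> v i \<and> v i \<le> 1 \<Longrightarrow>
      \<exists>u\<in>{L..U}. s0 - (\<Sum>i\<in>I. \<alpha> i * v i) + F (x0 + (\<Sum>i\<in>I. \<beta> i * v i) + u) \<le> M"
  shows "\<exists>q0 q. \<forall>v. (\<forall>i\<in>I. 0 \<le> v i \<and> v i \<le> 1) \<longrightarrow>
      q0 + (\<Sum>i\<in>I. q i * v i) \<in> {L..U} \<and>
      s0 - (\<Sum>i\<in>I. \<alpha> i * v i) + F (x0 + (\<Sum>i\<in>I. \<beta> i * v i) + (q0 + (\<Sum>i\<in>I. q i * v i))) \<le> M"
proof -
  obtain u0 where u0: "L \<le> u0" "u0 \<le> U" "s0 + F (x0 + u0) \<le> M"
    using feas[of "\<lambda>_. 0"] by auto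
  define P where "P = {i\<in>I. 0 < \<beta> i}"
  define N where "N = {i\<in>I. 0 < - \<beta> i}"
  have PN: "finite P" "finite N" "P \<subseteq> I" "N \<subseteq> I" "P \<inter> N = {}" using fin unfolding P_def N_def by auto
  obtain y where y: "\<And>i. i \<in> P \<Longrightarrow> 0 \<le> y i \<and> y i \<le> \<beta> i" "(\<Sum>i\<in>P. \<beta> i - y i) \<le> u0 - L"
    "\<And>\<mu>. 0 \<le> \<mu> \<Longrightarrow> (\<forall>i\<in>P. \<mu> * y i \<le> \<alpha> i) \<or>
      (\<forall>i\<in>P. y i < \<beta> i \<longrightarrow> \<alpha> i \<le> \<mu> * y i) \<and> (\<Sum>i\<in>P. \<beta> i - y i) = u0 - L"
    using water_filling[of P \<beta> \<alpha> "u0 - L"] PN \<alpha> u0 unfolding P_def by (auto simp: less_imp_le)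
  obtain y' where y': "\<And>i. i \<in> N \<Longrightarrow> 0 \<le> y' i \<and> y' i \<le> - \<beta> i" "(\<Sum>i\<in>N. - \<beta> i - y' i) \<le> U - u0"
    "\<And>\<mu>. 0 \<le> \<mu> \<Longrightarrow> (\<forall>i\<in>N. \<mu> * y' i \<le> \<alpha> i) \<or>
      (\<forall>i\<in>N. y' i < - \<beta> i \<longrightarrow> \<alpha> i \<le> \<mu> * y' i) \<and> (\<Sum>i\<in>N. - \<beta> i - y' i) = U - u0"
    using water_filling[of N "\<lambda>i. - \<beta> i" \<alpha> "U - u0"] PN \<alpha> u0 unfolding N_def by (auto simp: less_imp_le)
  \<comment> \<open>\<open>Y i\<close> is the slope of state plus control along edge
    \<open>i\<close>; subtracting the slope \<open>\<beta> i\<close> of the state leaves the slope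
    of the control.\<close>
  define Y where "Y i = (if i \<in> P then y i else if i \<in> N then - y' i else 0)" for i
  have YP: "Y i = y i" if "i \<in> P" for i using that by (simp add: Y_def)
  have YN: "- Y i = y' i" if "i \<in> N" for i using that PN(5) by (auto simp: Y_def)
  have Y0: "Y i = 0" "\<beta> i = 0" if "i \<in> I" "i \<notin> P" "i \<notin> N" for i
    using that by (auto simp: Y_def P_def N_def)
  define q where "q i = Y i - \<beta> i" for i
  have Bq: "x0 + (\<Sum>i\<in>I. \<beta> i * v i) + (u0 + (\<Sum>i\<in>I. q i * v i)) = x0 + u0 + (\<Sum>i\<in>I. Y i * v i)" for v
    unfolding q_def by (simp add: sum_subtractf algebra_simps)
  have "u0 + (\<Sum>i\<in>I. q i * v i) \<in> {L..U} \<and>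
      s0 - (\<Sum>i\<in>I. \<alpha> i * v i) + F (x0 + (\<Sum>i\<in>I. \<beta> i * v i) + (u0 + (\<Sum>i\<in>I. q i * v i))) \<le> M"
    if v: "\<forall>i\<in>I. 0 \<le> v i \<and> v i \<le> 1" for v
  proof
    \<comment> \<open>The terms over \<open>P\<close> only lower the control and those over
      \<open>N\<close> only raise it, so each end of \<open>[L, U]\<close> is protected by its own
      budget.\<close>
    have split: "(\<Sum>i\<in>I. q i * v i) = (\<Sum>i\<in>P. q i * v i) + (\<Sum>i\<in>N. q i * v i)"
    proof -
      have "(\<Sum>i\<in>I. q i * v i) = (\<Sum>i\<in>P \<union> N. q i * v i)"
        using fin PN Y0 by (intro sum.mono_neutral_right) (auto simp: q_def)
      then show ?thesis using PN by (simp add: sum.union_disjoint)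
    qed
    have P1: "- (\<beta> i - y i) \<le> q i * v i \<and> q i * v i \<le> 0" if "i \<in> P" for i
    proof -
      have "0 \<le> \<beta> i - y i" "0 \<le> v i" "v i \<le> 1" using y(1)[OF that] v that PN by auto
      then have "(\<beta> i - y i) * v i \<le> \<beta> i - y i" "0 \<le> (\<beta> i - y i) * v i"
        by (auto intro: mult_left_le)
      then show ?thesis using YP[OF that] by (simp add: q_def algebra_simps)
    qed
    have N1: "q i * v i \<le> - \<beta> i - y' i \<and> 0 \<le> q i * v i" if "i \<in> N" for i
    proof -
      have "0 \<le> - \<beta> i - y' i" "0 \<le> v i" "v i \<le> 1" using y'(1)[OF that] v that PN by auto
      then have "(- \<beta> i - y' i) * v i \<le> - \<beta> i - y' i" "0 \<le> (- \<beta> i - y' i) * v i"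
        by (auto intro: mult_left_le)
      moreover have "q i = - \<beta> i - y' i" using YN[OF that] by (simp add: q_def)
      ultimately show ?thesis by simp
    qed
    have "(\<Sum>i\<in>P. q i * v i) \<le> 0" using P1 by (intro sum_nonpos) auto
    moreover have "0 \<le> (\<Sum>i\<in>N. q i * v i)" using N1 by (intro sum_nonneg) auto
    moreover have "(\<Sum>i\<in>P. - (\<beta> i - y i)) \<le> (\<Sum>i\<in>P. q i * v i)" using P1 by (intro sum_mono) auto
    then have "- (\<Sum>i\<in>P. \<beta> i - y i) \<le> (\<Sum>i\<in>P. q i * v i)" by (simp only: sum_negf)
    moreover have "(\<Sum>i\<in>N. q i * v i) \<le> (\<Sum>i\<in>N. - \<beta> i - y' i)" using N1 by (intro sum_mono) auto
    ultimately show "u0 + (\<Sum>i\<in>I. q i * v i) \<in> {L..U}"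
      using y(2) y'(2) unfolding split by auto
    define yv where "yv = x0 + u0 + (\<Sum>i\<in>I. Y i * v i)"
    \<comment> \<open>A supporting line at the reached state. The sign of its slope decides which
      end of \<open>[L, U]\<close> is critical.\<close>
    obtain l where sg: "\<And>t. F yv + l * (t - yv) \<le> F t"
      using convex_le_Inf_differential[OF F, of yv] by auto
    have "s0 - (\<Sum>i\<in>I. \<alpha> i * v i) + F yv \<le> M"
    proof (cases "0 \<le> l")
      case True
      show ?thesis unfolding yv_def
      proof (rule affine_control_bound_at_subgradient[where \<mu> = l and L = L and \<beta> = \<beta> and F = F])
        show "(\<forall>i\<in>{i\<in>I. 0 < \<beta> i}. l * Y i \<le> \<alpha> i) \<or>
          (\<forall>i\<in>{i\<in>I. 0 < \<beta> i}. Y i < \<beta> i \<longrightarrow> \<alpha> i \<le> l * Y i) \<and>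
          (\<Sum>i\<in>{i\<in>I. 0 < \<beta> i}. \<beta> i - Y i) = u0 - L"
          using y(3)[OF True] YP unfolding P_def[symmetric] by simp
        show "Y i \<le> \<beta> i" if "i \<in> I" "0 < \<beta> i" for i
          using y(1)[of i] YP[of i] that unfolding P_def by auto
        show "Y i \<le> 0" if "i \<in> I" "\<beta> i \<le> 0" for i
          using y'(1)[of i] that PN unfolding Y_def P_def by auto
        show "\<exists>u\<ge>L. s0 - (\<Sum>i\<in>I. \<alpha> i * v i) + F (x0 + (\<Sum>i\<in>I. \<beta> i * v i) + u) \<le> M"
          if "\<forall>i\<in>I. 0 \<le> v i \<and> v i \<le> 1" for v
          using feas[OF that] by auto
      qed (use fin True \<alpha> u0 v sg in \<open>auto simp: yv_def\<close>)
    next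
      case False
      then have neg: "0 \<le> - l" by simp
      \<comment> \<open>Reflecting the real line makes the slope nonnegative, exchanges increasing
        and decreasing edges, and turns \<open>-U\<close> into the lower bound of the
        control.\<close>
      have yv': "yv = - (- x0 + - u0 + (\<Sum>i\<in>I. - Y i * v i))"
        unfolding yv_def by (simp add: sum_negf)
      show ?thesis unfolding yv'
      proof (rule affine_control_bound_at_subgradient[where \<mu> = "- l" and L = "- U" and \<beta> = "\<lambda>i. - \<beta> i"
            and F = "\<lambda>t. F (- t)"])
        show "(\<forall>i\<in>{i\<in>I. 0 < - \<beta> i}. - l * - Y i \<le> \<alpha> i) \<or>
          (\<forall>i\<in>{i\<in>I. 0 < - \<beta> i}. - Y i < - \<beta> i \<longrightarrow> \<alpha> i \<le> - l * - Y i) \<and>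
          (\<Sum>i\<in>{i\<in>I. 0 < - \<beta> i}. - \<beta> i - - Y i) = - u0 - - U"
          using y'(3)[OF neg] unfolding N_def[symmetric] using YN by simp
        show "- Y i \<le> - \<beta> i" if "i \<in> I" "0 < - \<beta> i" for i
          using y'(1)[of i] YN[of i] that unfolding N_def by auto
        show "- Y i \<le> 0" if "i \<in> I" "- \<beta> i \<le> 0" for i
          using y(1)[of i] that PN unfolding Y_def N_def by auto
        show "\<exists>u\<ge>- U. s0 - (\<Sum>i\<in>I. \<alpha> i * v i) + F (- (- x0 + (\<Sum>i\<in>I. - \<beta> i * v i) + u)) \<le> M"
          if v: "\<forall>i\<in>I. 0 \<le> v i \<and> v i \<le> 1" for v
        proof -
          obtain u where "u \<in> {L..U}"
            "s0 - (\<Sum>i\<in>I. \<alpha> i * v i) + F (x0 + (\<Sum>i\<in>I. \<beta> i * v i) + u) \<le> M"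
            using feas[OF v] by blast
          moreover have "- (- x0 + (\<Sum>i\<in>I. - \<beta> i * v i) + - u) = x0 + (\<Sum>i\<in>I. \<beta> i * v i) + u"
            by (simp add: sum_negf)
          ultimately show ?thesis by (intro exI[of _ "- u"]) (simp only: atLeastAtMost_iff neg_le_iff_le simp_thms)
        qed
        show "F (- (- x0 + - u0 + (\<Sum>i\<in>I. - Y i * v i))) +
            - l * (t - (- x0 + - u0 + (\<Sum>i\<in>I. - Y i * v i))) \<le> F (- t)" for t
          using sg[of "- t"] unfolding yv_def by (simp add: sum_negf algebra_simps)
      qed (use fin neg \<alpha> u0 v in \<open>auto simp: add.commute\<close>)
    qed
    then show "s0 - (\<Sum>i\<in>I. \<alpha> i * v i) + F (x0 + (\<Sum>i\<in>I. \<beta> i * v i) + (u0 + (\<Sum>i\<in>I. q i * v i))) \<le> M"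
      unfolding Bq yv_def .
  qed
  then show ?thesis by blast
qed

section \<open>Affine functions on boxes\<close>

text \<open>A property of functions rather than of coefficient families, so that accumulated costs
  and states are recognised as affine by closure rules.\<close>

definition affine_in :: "'a set \<Rightarrow> (('a \<Rightarrow> real) \<Rightarrow> real) \<Rightarrow> bool" where
  "affine_in I f \<longleftrightarrow> (\<exists>a0 a. \<forall>w. f w = a0 + (\<Sum>i\<in>I. a i * w i))"

lemma affine_in_const: "affine_in I (\<lambda>w. r)"
  unfolding affine_in_def by (intro exI[of _ r] exI[of _ "\<lambda>_. 0"]) simp

lemma affine_in_coordinate:
  assumes "finite I" "j \<in> I"
  shows "affine_in I (\<lambda>w. w j)"
  unfolding affine_in_def
  by (intro exI[of _ 0] exI[of _ "\<lambda>i. if i = j then 1 else 0"])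
    (use assms in \<open>simp add: if_distrib[of "\<lambda>x. x * _"] cong: if_cong\<close>)

lemma affine_in_add:
  assumes "affine_in I f" "affine_in I g"
  shows "affine_in I (\<lambda>w. f w + g w)"
proof -
  obtain a0 a b0 b where "\<And>w. f w = a0 + (\<Sum>i\<in>I. a i * w i)" "\<And>w. g w = b0 + (\<Sum>i\<in>I. b i * w i)"
    using assms unfolding affine_in_def by blast
  then show ?thesis unfolding affine_in_def
    by (intro exI[of _ "a0 + b0"] exI[of _ "\<lambda>i. a i + b i"]) (simp add: sum.distrib algebra_simps)
qed

lemma affine_in_cmult:
  assumes "affine_in I f"
  shows "affine_in I (\<lambda>w. r * f w)"
proof -
  obtain a0 a where "\<And>w. f w = a0 + (\<Sum>i\<in>I. a i * w i)"
    using assms unfolding affine_in_def by blast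
  then show ?thesis unfolding affine_in_def
    by (intro exI[of _ "r * a0"] exI[of _ "\<lambda>i. r * a i"]) (simp add: sum_distrib_left algebra_simps)
qed

lemma affine_in_sum:
  assumes "\<And>j. j \<in> A \<Longrightarrow> affine_in I (f j)"
  shows "affine_in I (\<lambda>w. \<Sum>j\<in>A. f j w)"
  using assms by (induction A rule: infinite_finite_induct) (auto intro: affine_in_const affine_in_add)

lemma affine_in_affine_at:
  assumes "finite I" "{1..<m} \<subseteq> I"
  shows "affine_in I (affine_at a m)"
  unfolding affine_at_def using assms
  by (intro affine_in_add affine_in_const affine_in_sum affine_in_cmult affine_in_coordinate) auto

lemma affine_in_state_after:
  assumes "finite I" "{1..k} \<subseteq> I"
  shows "affine_in I (state_after x1 q k)"
  unfolding state_after_def using assms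
  by (intro affine_in_add affine_in_const affine_in_sum affine_in_affine_at affine_in_coordinate) auto

text \<open>A degenerate edge has \<open>d i = 0\<close>, where \<open>x / 0 = 0\<close> gives the right coordinate.\<close>

lemma box_coordinates:
  fixes lo hi :: "'a \<Rightarrow> real"
  assumes "\<forall>i\<in>I. lo i \<le> hi i"
  obtains d p where "\<forall>i\<in>I. if up i then 0 \<le> d i else d i \<le> 0"
    and "\<forall>v. (\<forall>i\<in>I. 0 \<le> v i \<and> v i \<le> 1) \<longrightarrow> (\<forall>i\<in>I. lo i \<le> p i + d i * v i \<and> p i + d i * v i \<le> hi i)"
    and "\<forall>w. (\<forall>i\<in>I. lo i \<le> w i \<and> w i \<le> hi i) \<longrightarrow>
      (\<forall>i\<in>I. 0 \<le> (w i - p i) / d i \<and> (w i - p i) / d i \<le> 1 \<and> p i + d i * ((w i - p i) / d i) = w i)"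
proof -
  \<comment> \<open>The corner \<open>p\<close> becomes the origin of the cube, and
    \<open>up\<close> prescribes for each edge the direction in which it is traversed.\<close>
  define p where "p i = (if up i then lo i else hi i)" for i
  define d where "d i = (if up i then hi i - lo i else lo i - hi i)" for i
  have into: "lo i \<le> p i + d i * r \<and> p i + d i * r \<le> hi i" if "i \<in> I" "0 \<le> r" "r \<le> 1" for i r
  proof -
    have "0 \<le> (hi i - lo i) * r" "(hi i - lo i) * r \<le> hi i - lo i"
      using assms that by (auto intro: mult_left_le)
    then show ?thesis by (auto simp: p_def d_def algebra_simps)
  qed
  have onto: "0 \<le> (r - p i) / d i \<and> (r - p i) / d i \<le> 1 \<and> p i + d i * ((r - p i) / d i) = r"
    if "i \<in> I" "lo i \<le> r" "r \<le> hi i" for i r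
  proof (cases "lo i = hi i")
    case True
    then show ?thesis using that by (simp add: p_def d_def)
  next
    case False
    then have "lo i < hi i" using that by simp
    then show ?thesis using that by (auto simp: p_def d_def field_simps)
  qed
  show ?thesis
    using assms into onto by (intro that[of d p]) (auto simp: d_def)
qed

text \<open>Traversing each edge in the direction in which \<open>s\<close> does not increase puts
  the origin of the cube at a maximiser of \<open>s\<close>, as \<open>affine_control_cube\<close>
  requires.\<close>

lemma affine_control_box:
  fixes F :: "real \<Rightarrow> real" and lo hi :: "'a \<Rightarrow> real"
  assumes fin: "finite I" and F: "convex_on UNIV F" and box: "\<forall>i\<in>I. lo i \<le> hi i"
    and s: "affine_in I s" and x: "affine_in I x"
    and feas: "\<And>w. \<forall>i\<in>I. lo i \<le> w i \<and> w i \<le> hi i \<Longrightarrow> \<exists>u\<in>{L..U}. s w + F (x w + u) \<le> M"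
  shows "\<exists>q0 q. \<forall>w. (\<forall>i\<in>I. lo i \<le> w i \<and> w i \<le> hi i) \<longrightarrow>
      q0 + (\<Sum>i\<in>I. q i * w i) \<in> {L..U} \<and> s w + F (x w + (q0 + (\<Sum>i\<in>I. q i * w i))) \<le> M"
proof -
  obtain a0 a where a: "\<And>w. s w = a0 + (\<Sum>i\<in>I. a i * w i)" using s unfolding affine_in_def by blast
  obtain b0 b where b: "\<And>w. x w = b0 + (\<Sum>i\<in>I. b i * w i)" using x unfolding affine_in_def by blast
  obtain d p where d: "\<forall>i\<in>I. if a i \<le> 0 then 0 \<le> d i else d i \<le> 0"
    and into: "\<forall>v. (\<forall>i\<in>I. 0 \<le> v i \<and> v i \<le> 1) \<longrightarrow> (\<forall>i\<in>I. lo i \<le> p i + d i * v i \<and> p i + d i * v i \<le> hi i)"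
    and onto: "\<forall>w. (\<forall>i\<in>I. lo i \<le> w i \<and> w i \<le> hi i) \<longrightarrow>
      (\<forall>i\<in>I. 0 \<le> (w i - p i) / d i \<and> (w i - p i) / d i \<le> 1 \<and> p i + d i * ((w i - p i) / d i) = w i)"
    by (rule box_coordinates[OF box, of "\<lambda>i. a i \<le> 0"])
  define s0 where "s0 = a0 + (\<Sum>i\<in>I. a i * p i)"
  define x0 where "x0 = b0 + (\<Sum>i\<in>I. b i * p i)"
  have sv: "s w = s0 - (\<Sum>i\<in>I. - (a i * d i) * v i)" and xv: "x w = x0 + (\<Sum>i\<in>I. b i * d i * v i)"
    if "\<forall>i\<in>I. p i + d i * v i = w i" for w v
  proof -
    have "(\<Sum>i\<in>I. r i * w i) = (\<Sum>i\<in>I. r i * p i) + (\<Sum>i\<in>I. r i * d i * v i)" for r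
      unfolding sum.distrib[symmetric] 
      by (intro sum.cong refl) (simp add: bspec[OF that, symmetric] algebra_simps)
    then show "s w = s0 - (\<Sum>i\<in>I. - (a i * d i) * v i)" "x w = x0 + (\<Sum>i\<in>I. b i * d i * v i)"
      unfolding a b s0_def x0_def by (simp_all add: sum_negf)
  qed
  have "\<exists>q0 q. \<forall>v. (\<forall>i\<in>I. 0 \<le> v i \<and> v i \<le> 1) \<longrightarrow>
      q0 + (\<Sum>i\<in>I. q i * v i) \<in> {L..U} \<and>
      s0 - (\<Sum>i\<in>I. - (a i * d i) * v i) + F (x0 + (\<Sum>i\<in>I. b i * d i * v i) + (q0 + (\<Sum>i\<in>I. q i * v i))) \<le> M"
  proof (rule affine_control_cube[OF fin F])
    show "0 \<le> - (a i * d i)" if "i \<in> I" for i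
      using bspec[OF d that] by (cases "a i \<le> 0") (auto simp: mult_le_0_iff)
    show "\<exists>u\<in>{L..U}. s0 - (\<Sum>i\<in>I. - (a i * d i) * v i) + F (x0 + (\<Sum>i\<in>I. b i * d i * v i) + u) \<le> M"
      if "\<forall>i\<in>I. 0 \<le> v i \<and> v i \<le> 1" for v
      using feas[OF into[THEN spec, THEN mp, OF that]] sv[of v "\<lambda>i. p i + d i * v i"] xv[of v "\<lambda>i. p i + d i * v i"] by simp
  qed
  then obtain q0 q where q: "\<And>v. \<forall>i\<in>I. 0 \<le> v i \<and> v i \<le> 1 \<Longrightarrow> q0 + (\<Sum>i\<in>I. q i * v i) \<in> {L..U} \<and>
      s0 - (\<Sum>i\<in>I. - (a i * d i) * v i) + F (x0 + (\<Sum>i\<in>I. b i * d i * v i) + (q0 + (\<Sum>i\<in>I. q i * v i))) \<le> M"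
    by blast
  \<comment> \<open>The policy is rewritten in the original coordinates; degenerate edges get
    coefficient \<open>q i / 0 = 0\<close>.\<close>
  have qw: "q0 - (\<Sum>i\<in>I. q i / d i * p i) + (\<Sum>i\<in>I. q i / d i * w i)
      = q0 + (\<Sum>i\<in>I. q i * ((w i - p i) / d i))" for w
    by (simp add: diff_divide_distrib sum_subtractf algebra_simps)
  have "q0 - (\<Sum>i\<in>I. q i / d i * p i) + (\<Sum>i\<in>I. q i / d i * w i) \<in> {L..U} \<and>
      s w + F (x w + (q0 - (\<Sum>i\<in>I. q i / d i * p i) + (\<Sum>i\<in>I. q i / d i * w i))) \<le> M"
    if w: "\<forall>i\<in>I. lo i \<le> w i \<and> w i \<le> hi i" for w
    unfolding qw using q[of "\<lambda>i. (w i - p i) / d i"] onto[THEN spec, THEN mp, OF w]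
      sv[of "\<lambda>i. (w i - p i) / d i" w] xv[of "\<lambda>i. (w i - p i) / d i" w] by simp
  then show ?thesis
    by (intro exI[of _ "q0 - (\<Sum>i\<in>I. q i / d i * p i)"] exI[of _ "\<lambda>i. q i / d i"]) blast
qed

text \<open>Here each edge is traversed in the direction in which \<open>x\<close> does not
  decrease, which supplies the nonnegative increments for \<open>affine_cost_cube\<close>.\<close>

lemma affine_cost_box:
  fixes h J :: "real \<Rightarrow> real" and lo hi :: "'a \<Rightarrow> real"
  assumes fin: "finite I" and h: "convex_on UNIV h" and J: "convex_on UNIV J"
    and box: "\<forall>i\<in>I. lo i \<le> hi i"
    and s: "affine_in I s" and x: "affine_in I x"
    and le: "\<And>w. \<forall>i\<in>I. lo i \<le> w i \<and> w i \<le> hi i \<Longrightarrow> s w + h (x w) + J (x w) \<le> M"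
  shows "\<exists>z0 z. \<forall>w. (\<forall>i\<in>I. lo i \<le> w i \<and> w i \<le> hi i) \<longrightarrow>
      h (x w) \<le> z0 + (\<Sum>i\<in>I. z i * w i) \<and> s w + (z0 + (\<Sum>i\<in>I. z i * w i)) + J (x w) \<le> M"
proof -
  obtain a0 a where a: "\<And>w. s w = a0 + (\<Sum>i\<in>I. a i * w i)" using s unfolding affine_in_def by blast
  obtain b0 b where b: "\<And>w. x w = b0 + (\<Sum>i\<in>I. b i * w i)" using x unfolding affine_in_def by blast
  obtain d p where d: "\<forall>i\<in>I. if 0 \<le> b i then 0 \<le> d i else d i \<le> 0"
    and into: "\<forall>v. (\<forall>i\<in>I. 0 \<le> v i \<and> v i \<le> 1) \<longrightarrow> (\<forall>i\<in>I. lo i \<le> p i + d i * v i \<and> p i + d i * v i \<le> hi i)"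
    and onto: "\<forall>w. (\<forall>i\<in>I. lo i \<le> w i \<and> w i \<le> hi i) \<longrightarrow>
      (\<forall>i\<in>I. 0 \<le> (w i - p i) / d i \<and> (w i - p i) / d i \<le> 1 \<and> p i + d i * ((w i - p i) / d i) = w i)"
    by (rule box_coordinates[OF box, of "\<lambda>i. 0 \<le> b i"])
  define s0 where "s0 = a0 + (\<Sum>i\<in>I. a i * p i)"
  define x0 where "x0 = b0 + (\<Sum>i\<in>I. b i * p i)"
  have sv: "s w = s0 + (\<Sum>i\<in>I. a i * d i * v i)" and xv: "x w = x0 + (\<Sum>i\<in>I. b i * d i * v i)"
    if "\<forall>i\<in>I. p i + d i * v i = w i" for w v
  proof -
    have "(\<Sum>i\<in>I. r i * w i) = (\<Sum>i\<in>I. r i * p i) + (\<Sum>i\<in>I. r i * d i * v i)" for r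
      unfolding sum.distrib[symmetric] 
      by (intro sum.cong refl) (simp add: bspec[OF that, symmetric] algebra_simps)
    then show "s w = s0 + (\<Sum>i\<in>I. a i * d i * v i)" "x w = x0 + (\<Sum>i\<in>I. b i * d i * v i)"
      unfolding a b s0_def x0_def by simp_all
  qed
  have "\<exists>z0 z. \<forall>v. (\<forall>i\<in>I. 0 \<le> v i \<and> v i \<le> 1) \<longrightarrow>
      h (x0 + (\<Sum>i\<in>I. b i * d i * v i)) \<le> z0 + (\<Sum>i\<in>I. z i * v i) \<and>
      s0 + (\<Sum>i\<in>I. a i * d i * v i) + (z0 + (\<Sum>i\<in>I. z i * v i)) + J (x0 + (\<Sum>i\<in>I. b i * d i * v i)) \<le> M"
  proof (rule affine_cost_cube[OF fin h J])
    show "0 \<le> b i * d i" if "i \<in> I" for i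
      using bspec[OF d that] by (cases "0 \<le> b i") (auto simp: zero_le_mult_iff)
    show "s0 + (\<Sum>i\<in>I. a i * d i * v i) + h (x0 + (\<Sum>i\<in>I. b i * d i * v i))
        + J (x0 + (\<Sum>i\<in>I. b i * d i * v i)) \<le> M"
      if "\<forall>i\<in>I. 0 \<le> v i \<and> v i \<le> 1" for v
      using le[OF into[THEN spec, THEN mp, OF that]] sv[of v "\<lambda>i. p i + d i * v i"] xv[of v "\<lambda>i. p i + d i * v i"] by simp
  qed
  then obtain z0 z where z: "\<And>v. \<forall>i\<in>I. 0 \<le> v i \<and> v i \<le> 1 \<Longrightarrow>
      h (x0 + (\<Sum>i\<in>I. b i * d i * v i)) \<le> z0 + (\<Sum>i\<in>I. z i * v i) \<and>
      s0 + (\<Sum>i\<in>I. a i * d i * v i) + (z0 + (\<Sum>i\<in>I. z i * v i)) + J (x0 + (\<Sum>i\<in>I. b i * d i * v i)) \<le> M"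
    by blast
  have zw: "z0 - (\<Sum>i\<in>I. z i / d i * p i) + (\<Sum>i\<in>I. z i / d i * w i)
      = z0 + (\<Sum>i\<in>I. z i * ((w i - p i) / d i))" for w
    by (simp add: diff_divide_distrib sum_subtractf algebra_simps)
  have "h (x w) \<le> z0 - (\<Sum>i\<in>I. z i / d i * p i) + (\<Sum>i\<in>I. z i / d i * w i) \<and>
      s w + (z0 - (\<Sum>i\<in>I. z i / d i * p i) + (\<Sum>i\<in>I. z i / d i * w i)) + J (x w) \<le> M"
    if w: "\<forall>i\<in>I. lo i \<le> w i \<and> w i \<le> hi i" for w
    unfolding zw using z[of "\<lambda>i. (w i - p i) / d i"] onto[THEN spec, THEN mp, OF w]
      sv[of "\<lambda>i. (w i - p i) / d i" w] xv[of "\<lambda>i. (w i - p i) / d i" w] by simp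
  then show ?thesis
    by (intro exI[of _ "z0 - (\<Sum>i\<in>I. z i / d i * p i)"] exI[of _ "\<lambda>i. z i / d i"]) blast
qed

section \<open>Optimality of affine policies\<close>

text \<open>Packs a separately obtained constant and family of slopes into one coefficient function;
  index 0 is free because the sum starts at 1.\<close>

lemma affine_at_fun_upd_0: "affine_at (a(0 := a0)) m w = a0 + (\<Sum>t\<in>{1..<m}. a t * w t)"
  unfolding affine_at_def by (intro arg_cong2[where f = "(+)"] sum.cong) auto

text \<open>One Bellman step, split in two: minimality in \<open>u\<close> makes the control lemma
  applicable with the worst-case continuation \<open>G\<close>, and then the maximum defining
  \<open>G\<close> dominates each \<open>w k\<close>, which makes the cost lemma applicable.\<close>

lemma affine_stage:
  fixes c L U wlo whi :: "nat \<Rightarrow> real" and W :: "nat \<Rightarrow> real set" and h :: "nat \<Rightarrow> real \<Rightarrow> real"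
  assumes data: "\<forall>k\<in>{1..T}. L k \<le> U k \<and> wlo k \<le> whi k \<and> W k = {wlo k..whi k} \<and> convex_on UNIV (h k)"
    and k: "k \<in> {1..T}"
    and s: "affine_in {1..<k} s" and x: "affine_in {1..<k} x"
    and le: "\<And>w. \<forall>i\<in>{1..<k}. wlo i \<le> w i \<and> w i \<le> whi i \<Longrightarrow> s w + opt_value T c L U W h k (x w) \<le> M"
  shows "\<exists>q z. (\<forall>w. (\<forall>i\<in>{1..<k}. wlo i \<le> w i \<and> w i \<le> whi i) \<longrightarrow> affine_at q k w \<in> {L k..U k}) \<and>
    (\<forall>w. (\<forall>i\<in>{1..<k + 1}. wlo i \<le> w i \<and> w i \<le> whi i) \<longrightarrow>
      h k (x w + affine_at q k w + w k) \<le> affine_at z (k + 1) w \<and>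
      s w + (c k * affine_at q k w + affine_at z (k + 1) w)
        + opt_value T c L U W h (k + 1) (x w + affine_at q k w + w k) \<le> M)"
proof -
  define J where "J = opt_value T c L U W h"
  define G where "G y = (SUP w\<in>W k. h k (y + w) + J (Suc k) (y + w))" for y
  have cpt: "\<forall>k\<in>{1..T}. L k \<le> U k \<and> compact (W k) \<and> W k \<noteq> {} \<and> convex_on UNIV (h k)"
    using data by auto
  have hk: "convex_on UNIV (h k)" using data k by blast
  have Jk: "convex_on UNIV (J (Suc k))" unfolding J_def using convex_on_opt_value[OF cpt] by simp
  have G: "convex_on UNIV G"
    unfolding G_def using cpt k by (intro convex_on_SUP_shift convex_on_add hk Jk) auto
  note max = opt_value_attained(1)[OF cpt k, where c = c, folded J_def, folded G_def]
  note min = opt_value_attained(2)[OF cpt k, where c = c, folded J_def, folded G_def]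
  have F: "convex_on UNIV (\<lambda>y. c k * y + G y)"
    by (intro convex_on_add G) (auto simp: convex_on_def algebra_simps)
  \<comment> \<open>Writing \<open>c k * u = c k * (x w + u) - c k * x w\<close> makes the stage
    cost a function of \<open>x w + u\<close> alone, at the price of a correction to
    \<open>s\<close>.\<close>
  have s': "affine_in {1..<k} (\<lambda>w. s w + - c k * x w)" by (intro affine_in_add affine_in_cmult s x)
  have box: "\<forall>i\<in>{1..<k + 1}. wlo i \<le> whi i" using data k by auto
  have "\<exists>q0 q. \<forall>w. (\<forall>i\<in>{1..<k}. wlo i \<le> w i \<and> w i \<le> whi i) \<longrightarrow>
      q0 + (\<Sum>i\<in>{1..<k}. q i * w i) \<in> {L k..U k} \<and>
      s w + - c k * x w + (c k * (x w + (q0 + (\<Sum>i\<in>{1..<k}. q i * w i)))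
        + G (x w + (q0 + (\<Sum>i\<in>{1..<k}. q i * w i)))) \<le> M"
  proof (rule affine_control_box[OF _ F _ s' x])
    fix w assume "\<forall>i\<in>{1..<k}. wlo i \<le> w i \<and> w i \<le> whi i"
    note le[OF this, folded J_def]
    moreover obtain u where "u \<in> {L k..U k}" "J k (x w) = c k * u + G (x w + u)"
      using min[of "x w"] by (rule is_min_onE)
    ultimately show "\<exists>u\<in>{L k..U k}. s w + - c k * x w + (c k * (x w + u) + G (x w + u)) \<le> M"
      by (intro bexI[of _ u]) (simp_all add: algebra_simps)
  qed (use box in auto)
  then obtain q where q: "\<And>w. \<forall>i\<in>{1..<k}. wlo i \<le> w i \<and> w i \<le> whi i \<Longrightarrow>
      affine_at q k w \<in> {L k..U k} \<and>
      s w + - c k * x w + (c k * (x w + affine_at q k w) + G (x w + affine_at q k w)) \<le> M"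
    unfolding affine_at_fun_upd_0[symmetric] by blast
  \<comment> \<open>The running cost may also depend on \<open>w k\<close>, so earlier affine
    functions are viewed with one more coordinate.\<close>
  have ext: "affine_in {1..<k + 1} f" if "affine_in {1..<k} f" for f
  proof -
    obtain a0 a where a: "\<And>w. f w = a0 + (\<Sum>i\<in>{1..<k}. a i * w i)"
      using \<open>affine_in {1..<k} f\<close> unfolding affine_in_def by blast
    have "f = affine_at (a(0 := a0)) k" unfolding affine_at_fun_upd_0 using a by auto
    then show ?thesis using affine_in_affine_at[of "{1..<k + 1}" k] by auto
  qed
  have "\<exists>z0 z. \<forall>w. (\<forall>i\<in>{1..<k + 1}. wlo i \<le> w i \<and> w i \<le> whi i) \<longrightarrow>
      h k (x w + affine_at q k w + w k) \<le> z0 + (\<Sum>i\<in>{1..<k + 1}. z i * w i) \<and>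
      s w + c k * affine_at q k w + (z0 + (\<Sum>i\<in>{1..<k + 1}. z i * w i))
        + J (Suc k) (x w + affine_at q k w + w k) \<le> M"
  proof (rule affine_cost_box[OF _ hk Jk box])
    fix w assume w: "\<forall>i\<in>{1..<k + 1}. wlo i \<le> w i \<and> w i \<le> whi i"
    then have "w k \<in> W k" using data k by auto
    then have "h k (x w + affine_at q k w + w k) + J (Suc k) (x w + affine_at q k w + w k)
        \<le> G (x w + affine_at q k w)"
      using max unfolding is_max_on_def by blast
    then show "s w + c k * affine_at q k w + h k (x w + affine_at q k w + w k)
        + J (Suc k) (x w + affine_at q k w + w k) \<le> M"
      using q[of w] w by (simp add: algebra_simps)
  next
    show "affine_in {1..<k + 1} (\<lambda>w. s w + c k * affine_at q k w)"
      by (intro affine_in_add affine_in_cmult ext s affine_in_affine_at) auto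
    show "affine_in {1..<k + 1} (\<lambda>w. x w + affine_at q k w + w k)"
      using k by (intro affine_in_add affine_in_coordinate ext x affine_in_affine_at) auto
  qed auto
  then obtain z where z: "\<And>w. \<forall>i\<in>{1..<k + 1}. wlo i \<le> w i \<and> w i \<le> whi i \<Longrightarrow>
      h k (x w + affine_at q k w + w k) \<le> affine_at z (k + 1) w \<and>
      s w + c k * affine_at q k w + affine_at z (k + 1) w + J (Suc k) (x w + affine_at q k w + w k) \<le> M"
    unfolding affine_at_fun_upd_0[symmetric] by blast
  show ?thesis
    by (rule exI[of _ q], rule exI[of _ z]) (use q z in \<open>simp add: J_def add.assoc\<close>)
qed

text \<open>Induction on the number of stages already equipped. The bounds are kept for all earlier
  stages as well, so that one family serves every \<open>k\<close>.\<close>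

lemma affine_policy_le:
  fixes c L U wlo whi :: "nat \<Rightarrow> real" and W :: "nat \<Rightarrow> real set" and h :: "nat \<Rightarrow> real \<Rightarrow> real"
  assumes data: "\<forall>k\<in>{1..T}. L k \<le> U k \<and> wlo k \<le> whi k \<and> W k = {wlo k..whi k} \<and> convex_on UNIV (h k)"
    and "n \<le> T"
  shows "\<exists>q z. \<forall>k\<in>{1..n}.
    (\<forall>w. (\<forall>i\<in>{1..<k}. wlo i \<le> w i \<and> w i \<le> whi i) \<longrightarrow> affine_at (q k) k w \<in> {L k..U k}) \<and>
    (\<forall>w. (\<forall>i\<in>{1..<k + 1}. wlo i \<le> w i \<and> w i \<le> whi i) \<longrightarrow>
      h k (state_after x1 q k w) \<le> affine_at (z k) (k + 1) w \<and>
      (\<Sum>t=1..k. c t * affine_at (q t) t w + affine_at (z t) (t + 1) w)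
        + opt_value T c L U W h (k + 1) (state_after x1 q k w) \<le> opt_value T c L U W h 1 x1)"
  using \<open>n \<le> T\<close>
proof (induction n)
  case 0
  then show ?case by simp
next
  case (Suc n)
  define J where "J = opt_value T c L U W h"
  define cost where "cost q z k w = (\<Sum>t=1..k. c t * affine_at (q t) t w + affine_at (z t) (t + 1) w)"
    for q z k w
  define good where "good q z k \<longleftrightarrow>
    (\<forall>w. (\<forall>i\<in>{1..<k}. wlo i \<le> w i \<and> w i \<le> whi i) \<longrightarrow> affine_at (q k) k w \<in> {L k..U k}) \<and>
    (\<forall>w. (\<forall>i\<in>{1..<k + 1}. wlo i \<le> w i \<and> w i \<le> whi i) \<longrightarrow>
      h k (state_after x1 q k w) \<le> affine_at (z k) (k + 1) w \<and>
      cost q z k w + J (k + 1) (state_after x1 q k w) \<le> J 1 x1)" for q z k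
  have "\<exists>q z. \<forall>k\<in>{1..n}. good q z k"
    unfolding good_def cost_def J_def by (rule Suc.IH) (use Suc.prems in simp)
  then obtain q z where qz: "\<And>k. k \<in> {1..n} \<Longrightarrow> good q z k" by blast
  have le: "cost q z n w + J (Suc n) (state_after x1 q n w) \<le> J 1 x1"
    if "\<forall>i\<in>{1..<Suc n}. wlo i \<le> w i \<and> w i \<le> whi i" for w
  \<comment> \<open>Before the first stage the cost is an empty sum and the state is
    \<open>x1\<close>, so the bound is an equality.\<close>
  proof (cases "n = 0")
    case True
    then show ?thesis by (simp add: cost_def state_after_def)
  next
    case False
    then show ?thesis using qz[of n] that unfolding good_def by auto
  qed
  have "affine_in {1..<Suc n} (cost q z n)"
    unfolding cost_def by (intro affine_in_sum affine_in_add affine_in_cmult affine_in_affine_at) auto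
  moreover have "affine_in {1..<Suc n} (state_after x1 q n)"
    by (intro affine_in_state_after) auto
  ultimately obtain q' z' where
    q': "\<And>w. \<forall>i\<in>{1..<Suc n}. wlo i \<le> w i \<and> w i \<le> whi i \<Longrightarrow> affine_at q' (Suc n) w \<in> {L (Suc n)..U (Suc n)}"
    and z': "\<And>w. \<forall>i\<in>{1..<Suc n + 1}. wlo i \<le> w i \<and> w i \<le> whi i \<Longrightarrow>
      h (Suc n) (state_after x1 q n w + affine_at q' (Suc n) w + w (Suc n)) \<le> affine_at z' (Suc n + 1) w \<and>
      cost q z n w + (c (Suc n) * affine_at q' (Suc n) w + affine_at z' (Suc n + 1) w)
        + J (Suc n + 1) (state_after x1 q n w + affine_at q' (Suc n) w + w (Suc n)) \<le> J 1 x1"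
    using affine_stage[OF data, of "Suc n" "cost q z n" "state_after x1 q n" c "J 1 x1"] Suc.prems le
    unfolding J_def by auto
  define Q where "Q = q(Suc n := q')"
  define Z where "Z = z(Suc n := z')"
  have old: "Q t = q t" "Z t = z t" if "t \<le> n" for t using that by (auto simp: Q_def Z_def)
  have cost_old: "cost Q Z k w = cost q z k w" if "k \<le> n" for k w
    unfolding cost_def using that old by (intro sum.cong) auto
  have state_old: "state_after x1 Q k w = state_after x1 q k w" if "k \<le> n" for k w
    unfolding state_after_def using that old by (intro arg_cong2[where f = "(+)"] sum.cong) auto
  have state_new: "state_after x1 Q (Suc n) w = state_after x1 q n w + affine_at q' (Suc n) w + w (Suc n)" for w
    using state_old[of n w] by (simp add: state_after_def Q_def)
  have cost_new: "cost Q Z (Suc n) w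
      = cost q z n w + (c (Suc n) * affine_at q' (Suc n) w + affine_at z' (Suc n + 1) w)" for w
    using cost_old[of n w] by (simp add: cost_def Q_def Z_def)
  have "good Q Z k" if "k \<in> {1..Suc n}" for k
  proof (cases "k = Suc n")
    case True
    have "Q (Suc n) = q'" "Z (Suc n) = z'" by (simp_all add: Q_def Z_def)
    then show ?thesis
      using q' z' unfolding True good_def state_new cost_new by simp
  next
    case False
    then have "k \<le> n" "k \<in> {1..n}" using that by auto
    then show ?thesis using qz[of k] unfolding good_def by (simp add: old cost_old state_old)
  qed
  then have "\<exists>q z. \<forall>k\<in>{1..Suc n}. good q z k" by blast
  then show ?case unfolding good_def cost_def J_def .
qed

text \<open>A greedy adversary: an admissible control cannot beat the Bellman minimum, a maximising
  disturbance realises the inner maximum, and the running cost is at least the true cost. Hence the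
  accumulated total never drops below the initial value.\<close>

lemma worst_case_history:
  fixes c L U :: "nat \<Rightarrow> real" and W :: "nat \<Rightarrow> real set" and h :: "nat \<Rightarrow> real \<Rightarrow> real"
  assumes data: "\<forall>k\<in>{1..T}. L k \<le> U k \<and> compact (W k) \<and> W k \<noteq> {} \<and> convex_on UNIV (h k)"
    and q: "\<And>k w. k \<in> {1..T} \<Longrightarrow> w \<in> histories W k \<Longrightarrow> affine_at (q k) k w \<in> {L k..U k}"
    and z: "\<And>k w. k \<in> {1..T} \<Longrightarrow> w \<in> histories W (k + 1) \<Longrightarrow>
      h k (state_after x1 q k w) \<le> affine_at (z k) (k + 1) w"
    and "n \<le> T"
  shows "\<exists>w\<in>histories W (n + 1). opt_value T c L U W h 1 x1 \<le>
    (\<Sum>t=1..n. c t * affine_at (q t) t w + affine_at (z t) (t + 1) w)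
      + opt_value T c L U W h (n + 1) (state_after x1 q n w)"
  using \<open>n \<le> T\<close>
proof (induction n)
  case 0
  then show ?case by (auto simp: histories_def state_after_def)
next
  case (Suc n)
  define J where "J = opt_value T c L U W h"
  define k where "k = Suc n"
  have k: "k \<in> {1..T}" using Suc.prems by (simp add: k_def)
  obtain w where w: "w \<in> histories W k"
    "J 1 x1 \<le> (\<Sum>t=1..n. c t * affine_at (q t) t w + affine_at (z t) (t + 1) w)
      + J k (state_after x1 q n w)"
    using Suc unfolding J_def k_def by auto
  define u where "u = affine_at (q k) k w"
  define y where "y = state_after x1 q n w + u"
  have u: "u \<in> {L k..U k}" unfolding u_def by (rule q[OF k w(1)])
  note att = opt_value_attained[OF data k, where c = c, folded J_def]
  obtain r where r: "r \<in> W k"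
    "(SUP w\<in>W k. h k (y + w) + J (Suc k) (y + w)) = h k (y + r) + J (Suc k) (y + r)"
    using att(1)[of y] by (rule is_max_onE)
  have "J k (state_after x1 q n w) \<le> c k * u + (SUP w\<in>W k. h k (y + w) + J (Suc k) (y + w))"
    using att(2)[of "state_after x1 q n w"] u unfolding is_min_on_def y_def by blast
  then have Jk: "J k (state_after x1 q n w) \<le> c k * u + (h k (y + r) + J (Suc k) (y + r))"
    unfolding r(2) .
  define w' where "w' = w(k := r)"
  have w': "w' \<in> histories W (k + 1)"
    using w(1) r(1) k unfolding histories_def w'_def
    by (auto simp: PiE_iff extensional_def less_Suc_eq)
  \<comment> \<open>Functions of \<open>w^m\<close> with \<open>m \<le> k\<close> do not read
    coordinate \<open>k\<close>. This covers the control at stage \<open>k\<close> and all costs up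
    to stage \<open>n = k - 1\<close>.\<close>
  have same: "affine_at a m w' = affine_at a m w" if "m \<le> k" for a m
    unfolding affine_at_def w'_def using that by (intro arg_cong2[where f = "(+)"] sum.cong) auto
  have same_sum: "(\<Sum>t=1..n. c t * affine_at (q t) t w' + affine_at (z t) (t + 1) w')
      = (\<Sum>t=1..n. c t * affine_at (q t) t w + affine_at (z t) (t + 1) w)"
    by (intro sum.cong) (auto simp: same k_def)
  have "state_after x1 q n w' = state_after x1 q n w"
    unfolding state_after_def by (intro arg_cong2[where f = "(+)"] sum.cong) (auto simp: same k_def, auto simp: w'_def k_def)
  then have st: "state_after x1 q k w' = y + r"
    using same[of k "q k"] by (simp add: y_def u_def state_after_def k_def) (simp add: w'_def k_def)
  have "h k (y + r) \<le> affine_at (z k) (k + 1) w'" using z[OF k w'] st by simp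
  then have "J 1 x1 \<le> (\<Sum>t=1..k. c t * affine_at (q t) t w' + affine_at (z t) (t + 1) w') + J (k + 1) (y + r)"
    using w(2) Jk same_sum same[of k "q k"] by (simp add: k_def u_def)
  then show ?case using w' st unfolding J_def k_def by (metis (no_types, lifting))
qed

theorem theorem3p1:
  fixes T :: nat
    and x1 :: real
    and c L U wlo whi :: "nat \<Rightarrow> real"
    and W :: "nat \<Rightarrow> real set"
    and h :: "nat \<Rightarrow> real \<Rightarrow> real"
  assumes "T \<ge> 1"
    and "\<forall>k\<in>{1..T}. c k \<ge> 0"
    and "\<forall>k\<in>{1..T}. L k \<le> U k"
    and "\<forall>k\<in>{1..T}. wlo k \<le> whi k"
    and "\<forall>k\<in>{1..T}. W k = {wlo k..whi k}"
    and "\<forall>k\<in>{1..T}. convex_on UNIV (h k)"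
    and "\<forall>k\<in>{1..T}. filterlim (h k) at_top at_infinity"
  shows "\<exists>q z :: nat \<Rightarrow> nat \<Rightarrow> real. \<forall>k\<in>{1..T}.
    (\<forall>w\<in>histories W k. L k \<le> affine_at (q k) k w \<and> affine_at (q k) k w \<le> U k) \<and>
    (\<forall>w\<in>histories W (k + 1). affine_at (z k) (k + 1) w \<ge> h k (state_after x1 q k w)) \<and>
    is_max_on
      (\<lambda>w. (\<Sum>t=1..k. c t * affine_at (q t) t w + affine_at (z t) (t + 1) w)
            + opt_value T c L U W h (k + 1) (state_after x1 q k w))
      (histories W (k + 1))
      (opt_value T c L U W h 1 x1)"
proof -
  have data: "\<forall>k\<in>{1..T}. L k \<le> U k \<and> wlo k \<le> whi k \<and> W k = {wlo k..whi k} \<and> convex_on UNIV (h k)"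
    using assms by blast
  then have cpt: "\<forall>k\<in>{1..T}. L k \<le> U k \<and> compact (W k) \<and> W k \<noteq> {} \<and> convex_on UNIV (h k)"
    by auto
  \<comment> \<open>The restriction \<open>m \<le> T + 1\<close> keeps all coordinates among the
    stages where \<open>W\<close> is known to be an interval.\<close>
  have box: "\<forall>i\<in>{1..<m}. wlo i \<le> w i \<and> w i \<le> whi i" if "w \<in> histories W m" "m \<le> T + 1" for w m
    using that assms(5) unfolding histories_def by (auto simp: PiE_iff)
  obtain q z where qz: "\<And>k. k \<in> {1..T} \<Longrightarrow>
    (\<forall>w. (\<forall>i\<in>{1..<k}. wlo i \<le> w i \<and> w i \<le> whi i) \<longrightarrow> affine_at (q k) k w \<in> {L k..U k}) \<and>
    (\<forall>w. (\<forall>i\<in>{1..<k + 1}. wlo i \<le> w i \<and> w i \<le> whi i) \<longrightarrow>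
      h k (state_after x1 q k w) \<le> affine_at (z k) (k + 1) w \<and>
      (\<Sum>t=1..k. c t * affine_at (q t) t w + affine_at (z t) (t + 1) w)
        + opt_value T c L U W h (k + 1) (state_after x1 q k w) \<le> opt_value T c L U W h 1 x1)"
    using affine_policy_le[OF data order_refl, of x1 c] by blast
  have q: "affine_at (q k) k w \<in> {L k..U k}" if "k \<in> {1..T}" "w \<in> histories W k" for k w
    using qz[OF that(1)] box[OF that(2)] that(1) by simp
  have z: "h k (state_after x1 q k w) \<le> affine_at (z k) (k + 1) w"
    and le: "(\<Sum>t=1..k. c t * affine_at (q t) t w + affine_at (z t) (t + 1) w)
        + opt_value T c L U W h (k + 1) (state_after x1 q k w) \<le> opt_value T c L U W h 1 x1"
    if "k \<in> {1..T}" "w \<in> histories W (k + 1)" for k w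
    using qz[OF that(1)] box[OF that(2)] that(1) by simp_all
  show ?thesis
  proof (rule exI[of _ q], rule exI[of _ z], intro ballI conjI)
    fix k assume k: "k \<in> {1..T}"
    \<comment> \<open>The adversary's history gives the lower bound; together with the upper bound
      valid for all histories it is a maximiser with exactly the optimal value.\<close>
    then obtain w where w: "w \<in> histories W (k + 1)" "opt_value T c L U W h 1 x1 \<le>
        (\<Sum>t=1..k. c t * affine_at (q t) t w + affine_at (z t) (t + 1) w)
          + opt_value T c L U W h (k + 1) (state_after x1 q k w)"
      using worst_case_history[OF cpt q z, of k c] by auto
    with le[OF k] show "is_max_on
        (\<lambda>w. (\<Sum>t=1..k. c t * affine_at (q t) t w + affine_at (z t) (t + 1) w)
              + opt_value T c L U W h (k + 1) (state_after x1 q k w))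
        (histories W (k + 1)) (opt_value T c L U W h 1 x1)"
      unfolding is_max_on_def by (meson antisym)
  qed (use q z in auto)
qed

end
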